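(* Let $\Omega\subset\mathbb{R}^n$ be a bounded open set with smooth boundary, $\omega\subset\Omega$ a nonempty subregion, $Z=H^1(\Omega)$, and let $\chi_\omega:H^1(\Omega)\to H^1(\omega)$ be the restriction operator. Consider the diffusion system with Neumann boundary condition $$\frac{\partial z}{\partial t}(\mu,t)=\Delta z(\mu,t)+Bu(t)\ \text{ in } \Omega\times(0,\infty),\qquad \frac{\partial z}{\partial \nu}(\eta,t)=0\ \text{ on } \partial\Omega\times(0,\infty),\qquad z(\mu,0)=z_0(\mu)\ \text{ in }\Omega,$$ with output $y(\cdot,t)=Cz(\cdot,t)$, where $B\in\mathcal{L}(\mathbb{R}^p,Z)$, $C\in\mathcal{L}(Z,\mathbb{R}^q)$, $u\in L^2(0,\infty;\mathbb{R}^p)$ and $z_0\in H^1(\Omega)$. Let $T\in\mathcal{L}(H^1(\Omega))$ and $T_\omega=\chi_\omega T$. Let $L_\omega$ generate a strongly continuous, exponentially stable semigroup $(S_{L_\omega}(t))_{t\ge 0}$ on $W=H^1(\omega)$, let $G_\omega\in\mathcal{L}(\mathbb{R}^p,W)$ and $\mathcal{H}_\omega\in\mathcal{L}(\mathbb{R}^q,W)$, and consider the dynamical system $$\frac{\partial w}{\partial t}(\mu,t)=L_\omega w(\mu,t)+G_\omega u(t)+\mathcal{H}_\omega y(\mu,t),\qquad w(\mu,0)=w_0(\mu),\qquad (\ast)$$ with homogeneous Neumann boundary condition $\frac{\partial w}{\partial \nu}=0$ (encoded in the domain of $L_\omega$). Suppose that the following conditions hold: (1) there exist $M\in\mathcal{L}(\mathbb{R}^q,H^1(\omega))$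 and $N\in\mathcal{L}(H^1(\omega))$ such that $MC+NT_\omega=I$, where $I$ denotes the identity of $Z$ followed by restriction to $\omega$ (i.e. $MCz+NT_\omega z=\chi_\omega z$ for all $z\in Z$); (2) $T_\omega\Delta-L_\omega T_\omega=\mathcal{H}_\omega C$ (as operators on $D(\Delta)$, the products being defined there) and $G_\omega=T_\omega B$. Then the diffusion system with output $y=Cz$ is $\omega_{E_G}$-observable (regionally exponentially general observable in $\omega$) by the dynamical system $(\ast)$, that is, $(\ast)$ is an $\omega_{E_G}$-estimator for $T_\omega z(\mu,t)$.
   Context: The operator $\Delta$ is the Laplacian with homogeneous Neumann boundary condition; it is assumed to generate a strongly continuous semigroup $(S_\Delta(t))_{t\ge0}$ on $Z=H^1(\Omega)$ and to be self-adjoint with compact resolvent. Its domain is denoted $D(\Delta)$. The solution of the diffusion system is the mild solution $$z(\cdot,t)=S_\Delta(t)z_0+\int_0^t S_\Delta(t-\tau)Bu(\tau)\,d\tau .$$ The solution $w$ of the dynamical system $(\ast)$ is likewise understood as the mild solution with respect to $(S_{L_\omega}(t))_{t\ge0}$, with $w_0\in W$. Exponential stability of $(S_{L_\omega}(t))_{t\ge0}$ on $W=H^1(\omega)$ means that there are constants $F,\sigma>0$ with $\|S_{L_\omega}(t)\|_{\mathcal{L}(W)}\le Fe^{-\sigma t}$ for all $t\ge 0$. Definition ($\omega_{E_G}$-estimator). The dynamical system $(\ast)$ is an $\omega_{E_G}$-estimator for $\chi_\omega Tz(\mu,t)$ if (a) $\lim_{t\to\infty}\|\chi_\omega Tz(\cdot,t)-w(\cdot,t)\|_{H^1(\omega)}=0$,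 where $z$ and $w$ are the solutions of the diffusion system and of $(\ast)$ respectively (for all initial states $z_0$, $w_0$ and all controls $u$), and (b) $\chi_\omega T$ maps $D(\Delta)$ into $D(L_\omega)$. Definition ($\omega_{E_G}$-observability). The diffusion system with output $y=Cz$ is $\omega_{E_G}$-observable if there exists a dynamical system of the form $(\ast)$ which is an $\omega_{E_G}$-estimator for it. *)

theory Defs
  imports "HOL-Analysis.Analysis"
begin

section \<open>Smooth functions, test functions, smooth boundary\<close>

primrec Ck_on :: "nat \<Rightarrow> 'a::euclidean_space set \<Rightarrow> ('a \<Rightarrow> real) \<Rightarrow> bool" where
  "Ck_on 0 S f \<longleftrightarrow> continuous_on S f"
| "Ck_on (Suc k) S f \<longleftrightarrow> (\<forall>x\<in>S. f differentiable (at x)) \<and>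
     (\<forall>v. Ck_on k S (\<lambda>x. frechet_derivative f (at x) v))"

definition smooth_on :: "'a::euclidean_space set \<Rightarrow> ('a \<Rightarrow> real) \<Rightarrow> bool" where
  "smooth_on S f \<longleftrightarrow> (\<forall>k. Ck_on k S f)"

definition test_function :: "'a::euclidean_space set \<Rightarrow> ('a \<Rightarrow> real) \<Rightarrow> bool" where
  "test_function U \<phi> \<longleftrightarrow> smooth_on UNIV \<phi> \<and>
     compact (closure {x. \<phi> x \<noteq> 0}) \<and> closure {x. \<phi> x \<noteq> 0} \<subseteq> U"

text \<open>Near each boundary point, \<open>U\<close> is the sublevel set of a smooth function with
  nonvanishing derivative; in particular \<open>U\<close> lies locally on one side of its boundary.\<close>

definition smooth_boundary :: "'a::euclidean_space set \<Rightarrow> bool" where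
  "smooth_boundary U \<longleftrightarrow> (\<forall>x\<in>frontier U. \<exists>V \<rho>. open V \<and> x \<in> V \<and> smooth_on V \<rho> \<and>
     (\<forall>y\<in>V. \<exists>v. frechet_derivative \<rho> (at y) v \<noteq> 0) \<and> U \<inter> V = {y\<in>V. \<rho> y < 0})"


section \<open>The Sobolev space \<open>H\<^sup>1(U)\<close>\<close>

definition square_integrable ::
    "'a::euclidean_space set \<Rightarrow> ('a \<Rightarrow> 'b::euclidean_space) \<Rightarrow> bool" where
  "square_integrable U f \<longleftrightarrow> f \<in> borel_measurable (lebesgue_on U) \<and>
     integrable (lebesgue_on U) (\<lambda>x. (norm (f x))\<^sup>2)"

definition has_weak_gradient ::
    "'a::euclidean_space set \<Rightarrow> ('a \<Rightarrow> real) \<Rightarrow> ('a \<Rightarrow> 'a) \<Rightarrow> bool" where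
  "has_weak_gradient U f F \<longleftrightarrow> square_integrable U f \<and> square_integrable U F \<and>
     (\<forall>\<phi>. test_function U \<phi> \<longrightarrow> (\<forall>b\<in>Basis.
        (LINT x|lebesgue_on U. f x * frechet_derivative \<phi> (at x) b)
          = - (LINT x|lebesgue_on U. (F x \<bullet> b) * \<phi> x)))"

definition H1 :: "'a::euclidean_space set \<Rightarrow> ('a \<Rightarrow> real) set" where
  "H1 U = {f. \<exists>F. has_weak_gradient U f F}"

text \<open>The elements of the Hilbert space \<open>H\<^sup>1(U)\<close> are classes of functions in \<^const>\<open>H1\<close> modulo
  equality almost everywhere.  Since \<open>U\<close> is a term and cannot index a type, a type \<open>'z\<close> is said
  to be \<open>H\<^sup>1(U)\<close> by means of a map \<open>val\<close> that sends each element to one of its representatives;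
  it identifies \<open>'z\<close>, as an inner product space, with the set of all those classes, with
  \<open>\<langle>f,g\<rangle> = \<integral> f g + \<integral> \<nabla>f \<bullet> \<nabla>g\<close>.  (Injectivity modulo null sets follows from the last
  clause; weak gradients are unique almost everywhere, so it does not matter which are used.)\<close>

definition is_H1 ::
    "'a::euclidean_space set \<Rightarrow> ('z::real_inner \<Rightarrow> 'a \<Rightarrow> real) \<Rightarrow> bool" where
  "is_H1 U val \<longleftrightarrow>
     (\<forall>z. val z \<in> H1 U) \<and>
     (\<forall>f\<in>H1 U. \<exists>z. AE x in lebesgue_on U. val z x = f x) \<and>
     (\<forall>z z'. AE x in lebesgue_on U. val (z + z') x = val z x + val z' x) \<and>
     (\<forall>c z. AE x in lebesgue_on U. val (c *\<^sub>R z) x = c * val z x) \<and>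
     (\<forall>z z' F F'. has_weak_gradient U (val z) F \<longrightarrow> has_weak_gradient U (val z') F' \<longrightarrow>
        z \<bullet> z' = (LINT x|lebesgue_on U. val z x * val z' x) + (LINT x|lebesgue_on U. F x \<bullet> F' x))"

definition restriction ::
    "'a::euclidean_space set \<Rightarrow> ('z \<Rightarrow> 'a \<Rightarrow> real) \<Rightarrow> ('w \<Rightarrow> 'a \<Rightarrow> real) \<Rightarrow> 'z \<Rightarrow> 'w" where
  "restriction \<omega> valZ valW z = (THE w. AE x in lebesgue_on \<omega>. valW w x = valZ z x)"


section \<open>The Laplacian with homogeneous Neumann boundary condition\<close>

definition has_weak_laplacian ::
    "'a::euclidean_space set \<Rightarrow> ('a \<Rightarrow> real) \<Rightarrow> ('a \<Rightarrow> real) \<Rightarrow> bool" where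
  "has_weak_laplacian U f g \<longleftrightarrow> square_integrable U f \<and> square_integrable U g \<and>
     (\<forall>\<phi>. test_function U \<phi> \<longrightarrow>
        (LINT x|lebesgue_on U. f x *
            (\<Sum>b\<in>Basis. frechet_derivative (\<lambda>y. frechet_derivative \<phi> (at y) b) (at x) b))
          = (LINT x|lebesgue_on U. g x * \<phi> x))"

text \<open>For \<open>f \<in> H\<^sup>1(U)\<close> with \<open>\<Delta>f \<in> L\<^sup>2(U)\<close> the normal derivative on \<open>\<partial>U\<close> is the functional
  \<open>\<psi> \<mapsto> \<integral> \<Delta>f \<psi> + \<integral> \<nabla>f \<bullet> \<nabla>\<psi>\<close> on \<open>H\<^sup>1(U)\<close> (Green's formula); the condition is that it
  vanishes.\<close>

definition neumann_bc :: "'a::euclidean_space set \<Rightarrow> ('a \<Rightarrow> real) \<Rightarrow> bool" where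
  "neumann_bc U f \<longleftrightarrow> (\<exists>F g. has_weak_gradient U f F \<and> has_weak_laplacian U f g \<and>
     (\<forall>\<psi> \<Psi>. has_weak_gradient U \<psi> \<Psi> \<longrightarrow>
        (LINT x|lebesgue_on U. g x * \<psi> x) + (LINT x|lebesgue_on U. F x \<bullet> \<Psi> x) = 0))"

text \<open>As an operator in the state space \<open>H\<^sup>1(U)\<close>, the domain requires \<open>\<Delta>f \<in> H\<^sup>1(U)\<close>.\<close>

definition laplacian_dom ::
    "'a::euclidean_space set \<Rightarrow> ('z \<Rightarrow> 'a \<Rightarrow> real) \<Rightarrow> 'z set" where
  "laplacian_dom U val =
     {z. neumann_bc U (val z) \<and> (\<exists>v. has_weak_laplacian U (val z) (val v))}"

definition laplacian ::
    "'a::euclidean_space set \<Rightarrow> ('z \<Rightarrow> 'a \<Rightarrow> real) \<Rightarrow> 'z \<Rightarrow> 'z" where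
  "laplacian U val z = (THE v. has_weak_laplacian U (val z) (val v))"


section \<open>Unbounded operators and strongly continuous semigroups\<close>

text \<open>An unbounded operator is a domain \<open>D\<close> together with a function \<open>A\<close>, of which only the
  values on \<open>D\<close> matter.\<close>

text \<open>\<open>A\<close> is densely defined and the graph of its adjoint is the graph of \<open>A\<close>.\<close>

definition self_adjoint :: "'z::real_inner set \<Rightarrow> ('z \<Rightarrow> 'z) \<Rightarrow> bool" where
  "self_adjoint D A \<longleftrightarrow> closure D = UNIV \<and>
     (\<forall>y y'. (\<forall>x\<in>D. A x \<bullet> y = x \<bullet> y') \<longleftrightarrow> y \<in> D \<and> y' = A y)"

definition compact_operator ::
    "('z::real_normed_vector \<Rightarrow>\<^sub>L 'w::real_normed_vector) \<Rightarrow> bool" where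
  "compact_operator R \<longleftrightarrow> (\<forall>X. bounded X \<longrightarrow> compact (closure (R ` X)))"

definition compact_resolvent :: "'z::real_normed_vector set \<Rightarrow> ('z \<Rightarrow> 'z) \<Rightarrow> bool" where
  "compact_resolvent D A \<longleftrightarrow> (\<exists>(l::real) (R :: 'z \<Rightarrow>\<^sub>L 'z).
     (\<forall>x. blinfun_apply R x \<in> D \<and> l *\<^sub>R blinfun_apply R x - A (blinfun_apply R x) = x) \<and>
     (\<forall>x\<in>D. blinfun_apply R (l *\<^sub>R x - A x) = x) \<and> compact_operator R)"

definition C0_semigroup :: "(real \<Rightarrow> 'z::real_normed_vector \<Rightarrow>\<^sub>L 'z) \<Rightarrow> bool" where
  "C0_semigroup S \<longleftrightarrow> S 0 = id_blinfun \<and>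
     (\<forall>s\<ge>0. \<forall>t\<ge>0. S (s + t) = S s o\<^sub>L S t) \<and>
     (\<forall>x. ((\<lambda>t. S t x) \<longlongrightarrow> x) (at_right 0))"

definition generates ::
    "'z::real_normed_vector set \<Rightarrow> ('z \<Rightarrow> 'z) \<Rightarrow> (real \<Rightarrow> 'z \<Rightarrow>\<^sub>L 'z) \<Rightarrow> bool" where
  "generates D A S \<longleftrightarrow> C0_semigroup S \<and>
     D = {x. \<exists>y. ((\<lambda>h. (S h x - x) /\<^sub>R h) \<longlongrightarrow> y) (at_right 0)} \<and>
     (\<forall>x\<in>D. ((\<lambda>h. (S h x - x) /\<^sub>R h) \<longlongrightarrow> A x) (at_right 0))"

definition exponentially_stable :: "(real \<Rightarrow> 'z::real_normed_vector \<Rightarrow>\<^sub>L 'z) \<Rightarrow> bool" where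
  "exponentially_stable S \<longleftrightarrow>
     (\<exists>F>0. \<exists>\<sigma>>0. \<forall>t\<ge>0. norm (S t) \<le> F * exp (- \<sigma> * t))"

definition mild_solution ::
    "(real \<Rightarrow> 'z::{banach,second_countable_topology} \<Rightarrow>\<^sub>L 'z) \<Rightarrow> 'z \<Rightarrow> (real \<Rightarrow> 'z) \<Rightarrow> real \<Rightarrow> 'z"
  where
  "mild_solution S x0 f t = S t x0 + (LINT \<tau>:{0..t}|lebesgue. S (t - \<tau>) (f \<tau>))"


section \<open>Estimators and observability\<close>

text \<open>Here \<open>S\<close>, \<open>D\<close> are the semigroup and the domain of the diffusion operator, \<open>SL\<close>, \<open>DL\<close>
  those of \<open>L\<^sub>\<omega>\<close>, and \<open>T\<omega>\<close> is the map \<open>\<chi>\<^sub>\<omega> T\<close>.\<close>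

definition \<omega>EG_estimator ::
    "(real \<Rightarrow> 'z::{real_inner,banach,second_countable_topology} \<Rightarrow>\<^sub>L 'z) \<Rightarrow> 'z set \<Rightarrow>
     ((real^'p) \<Rightarrow>\<^sub>L 'z) \<Rightarrow> ('z \<Rightarrow>\<^sub>L (real^'q)) \<Rightarrow> ('z \<Rightarrow> 'w) \<Rightarrow>
     (real \<Rightarrow> 'w::{real_inner,banach,second_countable_topology} \<Rightarrow>\<^sub>L 'w) \<Rightarrow> 'w set \<Rightarrow>
     ((real^'p) \<Rightarrow>\<^sub>L 'w) \<Rightarrow> ((real^'q) \<Rightarrow>\<^sub>L 'w) \<Rightarrow> bool" where
  "\<omega>EG_estimator S D B C T\<omega> SL DL G H \<longleftrightarrow>
     (\<forall>z0 w0 u. square_integrable {0<..} u \<longrightarrow>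
        (let z = mild_solution S z0 (\<lambda>\<tau>. B (u \<tau>));
             w = mild_solution SL w0 (\<lambda>\<tau>. G (u \<tau>) + H (C (z \<tau>)))
         in ((\<lambda>t. norm (T\<omega> (z t) - w t)) \<longlongrightarrow> 0) at_top)) \<and>
     T\<omega> ` D \<subseteq> DL"

text \<open>The standing assumptions on the operator \<open>L\<^sub>\<omega>\<close> in the dynamical system
  \<open>w' = L\<^sub>\<omega> w + G u + H y\<close>; the boundary condition on \<open>w\<close> is part of the domain of \<open>L\<^sub>\<omega>\<close>.\<close>

definition estimator_operator ::
    "'a::euclidean_space set \<Rightarrow> ('w::real_normed_vector \<Rightarrow> 'a \<Rightarrow> real) \<Rightarrow>
     'w set \<Rightarrow> ('w \<Rightarrow> 'w) \<Rightarrow> (real \<Rightarrow> 'w \<Rightarrow>\<^sub>L 'w) \<Rightarrow> bool" where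
  "estimator_operator \<omega> valW DL L SL \<longleftrightarrow>
     generates DL L SL \<and> exponentially_stable SL \<and> (\<forall>w\<in>DL. neumann_bc \<omega> (valW w))"

definition \<omega>EG_observable ::
    "'a::euclidean_space set \<Rightarrow>
     ('w::{real_inner,banach,second_countable_topology} \<Rightarrow> 'a \<Rightarrow> real) \<Rightarrow>
     (real \<Rightarrow> 'z::{real_inner,banach,second_countable_topology} \<Rightarrow>\<^sub>L 'z) \<Rightarrow> 'z set \<Rightarrow>
     ((real^'p) \<Rightarrow>\<^sub>L 'z) \<Rightarrow> ('z \<Rightarrow>\<^sub>L (real^'q)) \<Rightarrow> ('z \<Rightarrow> 'w) \<Rightarrow> bool" where
  "\<omega>EG_observable \<omega> valW S D B C T\<omega> \<longleftrightarrow>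
     (\<exists>DL L SL G H. estimator_operator \<omega> valW DL L SL \<and> \<omega>EG_estimator S D B C T\<omega> SL DL G H)"

end

theory Submission
  imports Defs
begin

text \<open>Put \<open>P = T\<^sub>\<omega>\<close> and \<open>Q = \<H>\<^sub>\<omega> C\<close>.  For \<open>x \<in> D(\<Delta>)\<close> the hypothesis
  \<open>P \<Delta> - L\<^sub>\<omega> P = Q\<close> says that \<open>\<sigma> \<mapsto> S\<^sub>L(t - \<sigma>) P S\<^sub>\<Delta>(\<sigma> - r) x\<close> has derivative
  \<open>S\<^sub>L(t - \<sigma>) Q S\<^sub>\<Delta>(\<sigma> - r) x\<close>.  Integrating over \<open>[r, t]\<close> and using density of \<open>D(\<Delta>)\<close>,
  \<open>P S\<^sub>\<Delta>(t - r) x = S\<^sub>L(t - r) P x + \<integral>\<^sub>r\<^sup>t S\<^sub>L(t - \<sigma>) Q S\<^sub>\<Delta>(\<sigma> - r) x d\<sigma>\<close> for every \<open>x\<close>.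
  Inserting this in the mild solution \<open>z\<close> and exchanging the order of integration gives
  \<open>P z(t) - w(t) = S\<^sub>L(t) (P z\<^sub>0 - w\<^sub>0)\<close>, which decays exponentially.\<close>

section \<open>Restriction of Sobolev functions\<close>

lemma integral_lebesgue_on:
  fixes f :: "'a::euclidean_space \<Rightarrow> 'b::{banach,second_countable_topology}"
  assumes "A \<in> sets lebesgue"
  shows "(LINT x|lebesgue_on A. f x) = (LINT x|lebesgue. indicator A x *\<^sub>R f x)"
  using assms by (intro integral_restrict_space) auto

lemma lebesgue_on_integral_subset:
  fixes f :: "'a::euclidean_space \<Rightarrow> 'b::{banach,second_countable_topology}"
  assumes "A \<in> sets lebesgue" "B \<in> sets lebesgue" "A \<subseteq> B" "\<And>x. x \<in> B - A \<Longrightarrow> f x = 0"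
  shows "(LINT x|lebesgue_on A. f x) = (LINT x|lebesgue_on B. f x)"
proof -
  have "indicator A x *\<^sub>R f x = indicator B x *\<^sub>R f x" for x
    using assms(3,4) by (auto simp: indicator_def)
  then have "(LINT x|lebesgue. indicator A x *\<^sub>R f x) = (LINT x|lebesgue. indicator B x *\<^sub>R f x)"
    by presburger
  then show ?thesis
    using assms(1,2) by (simp only: integral_lebesgue_on)
qed

lemma integrable_lebesgue_on_subset:
  fixes f :: "'a::euclidean_space \<Rightarrow> 'b::{banach,second_countable_topology}"
  assumes "integrable (lebesgue_on B) f" "A \<in> sets lebesgue" "B \<in> sets lebesgue" "A \<subseteq> B"
  shows "integrable (lebesgue_on A) f"
  using assms set_integrable_subset[of lebesgue B f A]
  by (simp add: integrable_restrict_space set_integrable_def)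

lemma square_integrable_subset:
  assumes "square_integrable B f" "A \<in> sets lebesgue" "B \<in> sets lebesgue" "A \<subseteq> B"
  shows "square_integrable A f"
  using assms unfolding square_integrable_def
  by (auto intro: measurable_restrict_mono integrable_lebesgue_on_subset)

lemma test_function_measurable:
  assumes "test_function U \<phi>"
  shows "(\<lambda>x. frechet_derivative \<phi> (at x) b) \<in> borel_measurable (lebesgue_on A)"
    and "\<phi> \<in> borel_measurable (lebesgue_on A)"
proof -
  have "smooth_on UNIV \<phi>" using assms by (simp add: test_function_def)
  then have "Ck_on (Suc 0) UNIV \<phi>" "Ck_on 0 UNIV \<phi>" unfolding smooth_on_def by blast+
  then have *: "continuous_on UNIV (\<lambda>x. frechet_derivative \<phi> (at x) b)" "continuous_on UNIV \<phi>" by auto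
  show "(\<lambda>x. frechet_derivative \<phi> (at x) b) \<in> borel_measurable (lebesgue_on A)"
    and "\<phi> \<in> borel_measurable (lebesgue_on A)"
    using *[THEN borel_measurable_continuous_onI]
    by (auto intro!: measurable_restrict_space1 measurable_completion)
qed

text \<open>A point outside \<open>U\<close> has an open neighbourhood disjoint from the closed
  support; there \<phi> is identically zero, so the derivative vanishes too.\<close>

lemma test_function_outside:
  assumes "test_function U \<phi>" "x \<notin> U"
  shows "\<phi> x = 0" and "frechet_derivative \<phi> (at x) b = 0"
proof -
  define N where "N = - closure {x. \<phi> x \<noteq> 0}"
  have N: "open N" "x \<in> N" using assms by (auto simp: N_def test_function_def)
  have zero: "\<phi> y = 0" if "y \<in> N" for y
    using that closure_subset[of "{x. \<phi> x \<noteq> 0}"] by (auto simp: N_def)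
  show "\<phi> x = 0" using zero N by blast
  have "(\<phi> has_derivative (\<lambda>_. 0)) (at x)"
    by (rule has_derivative_transform_within_open[of "\<lambda>_. 0" _ _ _ N]) (use N zero in auto)
  then show "frechet_derivative \<phi> (at x) b = 0"
    by (simp flip: frechet_derivative_at)
qed

text \<open>A test function on \<open>V\<close> is also one on \<open>U\<close>, and it vanishes
  with its derivatives off \<open>V\<close>; the integrals over the two sets in the defining
  identity therefore coincide.\<close>

lemma has_weak_gradient_subset:
  assumes U: "has_weak_gradient U f F" and "open U" "open V" "V \<subseteq> U"
  shows "has_weak_gradient V f F"
  unfolding has_weak_gradient_def
proof (intro conjI allI impI ballI)
  have sets: "U \<in> sets lebesgue" "V \<in> sets lebesgue" using assms by auto
  show "square_integrable V f" "square_integrable V F"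
    using U assms(4) sets unfolding has_weak_gradient_def by (auto intro: square_integrable_subset)
  fix \<phi> :: "'a \<Rightarrow> real" and b :: 'a assume \<phi>: "test_function V \<phi>" and b: "b \<in> Basis"
  have "test_function U \<phi>" using \<phi> \<open>V \<subseteq> U\<close> by (auto simp: test_function_def)
  then have "(LINT x|lebesgue_on U. f x * frechet_derivative \<phi> (at x) b)
      = - (LINT x|lebesgue_on U. (F x \<bullet> b) * \<phi> x)"
    using U b by (simp add: has_weak_gradient_def)
  moreover have "(LINT x|lebesgue_on V. f x * frechet_derivative \<phi> (at x) b)
      = (LINT x|lebesgue_on U. f x * frechet_derivative \<phi> (at x) b)"
    by (rule lebesgue_on_integral_subset) (use sets assms(4) test_function_outside[OF \<phi>] in auto)
  moreover have "(LINT x|lebesgue_on V. (F x \<bullet> b) * \<phi> x) = (LINT x|lebesgue_on U. (F x \<bullet> b) * \<phi> x)"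
    by (rule lebesgue_on_integral_subset) (use sets assms(4) test_function_outside[OF \<phi>] in auto)
  ultimately show "(LINT x|lebesgue_on V. f x * frechet_derivative \<phi> (at x) b)
      = - (LINT x|lebesgue_on V. (F x \<bullet> b) * \<phi> x)" by simp
qed

text \<open>The representative picked by \<open>val\<close> is known only up to null sets; the
  defining integrals do not see this ambiguity.\<close>

lemma has_weak_gradient_cong_AE:
  assumes "has_weak_gradient U f F" "square_integrable U g" and ae: "AE x in lebesgue_on U. g x = f x"
  shows "has_weak_gradient U g F"
  unfolding has_weak_gradient_def
proof (intro conjI allI impI ballI)
  show "square_integrable U g" "square_integrable U F"
    using assms by (auto simp: has_weak_gradient_def)
  fix \<phi> :: "'a \<Rightarrow> real" and b :: 'a assume \<phi>: "test_function U \<phi>" and b: "b \<in> Basis"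
  have [measurable]: "f \<in> borel_measurable (lebesgue_on U)" "g \<in> borel_measurable (lebesgue_on U)"
    using assms by (auto simp: has_weak_gradient_def square_integrable_def)
  note [measurable] = test_function_measurable[OF \<phi>]
  have "(LINT x|lebesgue_on U. g x * frechet_derivative \<phi> (at x) b)
      = (LINT x|lebesgue_on U. f x * frechet_derivative \<phi> (at x) b)"
    by (rule integral_cong_AE) (use ae in auto)
  then show "(LINT x|lebesgue_on U. g x * frechet_derivative \<phi> (at x) b)
      = - (LINT x|lebesgue_on U. (F x \<bullet> b) * \<phi> x)"
    using assms(1) \<phi> b by (simp add: has_weak_gradient_def)
qed

section \<open>The space of classes and the restriction operator\<close>

lemma H1_square_integrable: "f \<in> H1 U \<Longrightarrow> square_integrable U f"
  by (auto simp: H1_def has_weak_gradient_def)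

lemma is_H1_add: "is_H1 U val \<Longrightarrow> AE x in lebesgue_on U. val (z + z') x = val z x + val z' x"
  unfolding is_H1_def by blast

lemma is_H1_scaleR: "is_H1 U val \<Longrightarrow> AE x in lebesgue_on U. val (c *\<^sub>R z) x = c * val z x"
  unfolding is_H1_def by blast

lemma is_H1_inner:
  "is_H1 U val \<Longrightarrow> has_weak_gradient U (val z) F \<Longrightarrow> has_weak_gradient U (val z') F' \<Longrightarrow>
    z \<bullet> z' = (LINT x|lebesgue_on U. val z x * val z' x) + (LINT x|lebesgue_on U. F x \<bullet> F' x)"
  unfolding is_H1_def by blast

lemma is_H1_surj: "is_H1 U val \<Longrightarrow> f \<in> H1 U \<Longrightarrow> \<exists>z. AE x in lebesgue_on U. val z x = f x"
  unfolding is_H1_def by blast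

lemma is_H1_mem: "is_H1 U val \<Longrightarrow> val z \<in> H1 U"
  unfolding is_H1_def by blast

text \<open>The difference is zero almost everywhere, so the zero field is one of its weak
  gradients. As the inner product formula in \<open>is_H1\<close> admits any weak gradient, the
  difference has norm zero.\<close>

lemma is_H1_eqI:
  assumes val: "is_H1 U val" and ae: "AE x in lebesgue_on U. val z x = val z' x"
  shows "z = z'"
proof -
  define d where "d = z + (- 1) *\<^sub>R z'"
  have d0: "AE x in lebesgue_on U. val d x = 0"
    using ae is_H1_add[OF val, of z "(- 1) *\<^sub>R z'"] is_H1_scaleR[OF val, of "- 1" z']
    unfolding d_def by eventually_elim simp
  have "has_weak_gradient U (val d) (\<lambda>_. 0)"
  proof (rule has_weak_gradient_cong_AE)
    show "has_weak_gradient U (\<lambda>_. 0) (\<lambda>_. 0)"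
      by (simp add: has_weak_gradient_def square_integrable_def)
  qed (use d0 H1_square_integrable is_H1_mem[OF val] in auto)
  then have "d \<bullet> d = (LINT x|lebesgue_on U. val d x * val d x) + (LINT x|lebesgue_on U. (0::'a) \<bullet> 0)"
    by (intro is_H1_inner[OF val])
  also have "(LINT x|lebesgue_on U. val d x * val d x) = 0"
    by (rule integral_eq_zero_AE) (use d0 in eventually_elim, simp)
  finally show ?thesis by (simp add: d_def)
qed

text \<open>Settles uniqueness for the definite description in \<open>restriction\<close>; linearity
  is later checked through it, by comparing representatives.\<close>

lemma restriction_eqI:
  assumes "is_H1 \<omega> valW" "AE x in lebesgue_on \<omega>. valW w x = valZ z x"
  shows "restriction \<omega> valZ valW z = w"
  unfolding restriction_def
proof (rule the_equality)
  fix w' assume "AE x in lebesgue_on \<omega>. valW w' x = valZ z x"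
  with assms(2) have "AE x in lebesgue_on \<omega>. valW w' x = valW w x" by eventually_elim simp
  then show "w' = w" by (rule is_H1_eqI[OF assms(1)])
qed fact

lemma AE_lebesgue_on_subset:
  assumes "AE x in lebesgue_on U. P x" "U \<in> sets lebesgue" "V \<in> sets lebesgue" "V \<subseteq> U"
  shows "AE x in lebesgue_on V. P x"
  using assms by (auto simp: AE_restrict_space_iff elim: eventually_mono)

text \<open>Existence for the definite description: weak gradients restrict to \<omega>, so
  \<open>valZ z\<close> lies in \<open>H1 \<omega>\<close> and is represented by some element
  because \<open>valW\<close> reaches every class.\<close>

lemma restriction_AE:
  assumes W: "is_H1 \<omega> valW" and Z: "is_H1 \<Omega> valZ" and "open \<Omega>" "open \<omega>" "\<omega> \<subseteq> \<Omega>"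
  shows "AE x in lebesgue_on \<omega>. valW (restriction \<omega> valZ valW z) x = valZ z x"
proof -
  have "valZ z \<in> H1 \<omega>"
    using is_H1_mem[OF Z, of z] has_weak_gradient_subset assms(3-5) unfolding H1_def by blast
  then obtain w where w: "AE x in lebesgue_on \<omega>. valW w x = valZ z x"
    using is_H1_surj[OF W] by blast
  have "restriction \<omega> valZ valW z = w" by (rule restriction_eqI[OF W]) (rule w)
  then show ?thesis using w by simp
qed

lemma integral_square_subset_le:
  assumes "square_integrable U f" "U \<in> sets lebesgue" "V \<in> sets lebesgue" "V \<subseteq> U"
  shows "(LINT x|lebesgue_on V. f x \<bullet> f x) \<le> (LINT x|lebesgue_on U. f x \<bullet> f x)"
proof -
  have "integrable (lebesgue_on U) (\<lambda>x. f x \<bullet> f x)"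
    using assms(1) by (simp add: square_integrable_def power2_norm_eq_inner)
  then have *: "integrable lebesgue (\<lambda>x. indicator U x *\<^sub>R (f x \<bullet> f x))"
      "integrable lebesgue (\<lambda>x. indicator V x *\<^sub>R (f x \<bullet> f x))"
    using integrable_lebesgue_on_subset[of U "\<lambda>x. f x \<bullet> f x" V] assms(2-4)
    by (auto simp: integrable_restrict_space)
  have "(LINT x|lebesgue. indicator V x *\<^sub>R (f x \<bullet> f x)) \<le> (LINT x|lebesgue. indicator U x *\<^sub>R (f x \<bullet> f x))"
    using assms(4) by (intro integral_mono *) (auto simp: indicator_def)
  then show ?thesis using assms(2,3) by (simp only: integral_lebesgue_on)
qed

text \<open>The same field \<open>F\<close> serves as weak gradient on both sets, so the squared
  norms are integrals of the same nonnegative functions over nested sets.\<close>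

lemma norm_restriction_le:
  assumes W: "is_H1 \<omega> valW" and Z: "is_H1 \<Omega> valZ" and o: "open \<Omega>" "open \<omega>" "\<omega> \<subseteq> \<Omega>"
  shows "norm (restriction \<omega> valZ valW z) \<le> norm z"
proof -
  define w where "w = restriction \<omega> valZ valW z"
  have ae: "AE x in lebesgue_on \<omega>. valW w x = valZ z x"
    unfolding w_def by (rule restriction_AE[OF W Z o])
  have sets: "\<Omega> \<in> sets lebesgue" "\<omega> \<in> sets lebesgue" using o by auto
  obtain F where F: "has_weak_gradient \<Omega> (valZ z) F"
    using is_H1_mem[OF Z, of z] unfolding H1_def by blast
  have si: "square_integrable \<Omega> (valZ z)" "square_integrable \<Omega> F" "square_integrable \<omega> (valW w)"
      "square_integrable \<omega> (valZ z)"
    using F H1_square_integrable[OF is_H1_mem[OF W, of w]] square_integrable_subset[OF _ sets(2,1) o(3)]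
    by (auto simp: has_weak_gradient_def)
  have "has_weak_gradient \<omega> (valW w) F"
    using has_weak_gradient_cong_AE[OF has_weak_gradient_subset[OF F o] si(3) ae] .
  then have "w \<bullet> w = (LINT x|lebesgue_on \<omega>. valW w x * valW w x) + (LINT x|lebesgue_on \<omega>. F x \<bullet> F x)"
    by (intro is_H1_inner[OF W])
  also have "(LINT x|lebesgue_on \<omega>. valW w x * valW w x) = (LINT x|lebesgue_on \<omega>. valZ z x \<bullet> valZ z x)"
    using si(3,4) ae by (intro integral_cong_AE) (auto simp: square_integrable_def)
  also have "(LINT x|lebesgue_on \<omega>. valZ z x \<bullet> valZ z x) + (LINT x|lebesgue_on \<omega>. F x \<bullet> F x)
      \<le> (LINT x|lebesgue_on \<Omega>. valZ z x \<bullet> valZ z x) + (LINT x|lebesgue_on \<Omega>. F x \<bullet> F x)"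
    by (intro add_mono integral_square_subset_le si sets o)
  also have "\<dots> = z \<bullet> z" using is_H1_inner[OF Z F F] by simp
  finally show ?thesis by (simp add: w_def norm_le)
qed

lemma bounded_linear_restriction:
  assumes W: "is_H1 \<omega> valW" and Z: "is_H1 \<Omega> valZ" and o: "open \<Omega>" "open \<omega>" "\<omega> \<subseteq> \<Omega>"
  shows "bounded_linear (restriction \<omega> valZ valW)"
proof (rule bounded_linear_intro[where K = 1])
  note ae = restriction_AE[OF W Z o]
  have sub: "AE x in lebesgue_on \<omega>. P x" if "AE x in lebesgue_on \<Omega>. P x" for P
    by (rule AE_lebesgue_on_subset[OF that]) (use o in auto)
  fix z z' and c :: real
  let ?R = "restriction \<omega> valZ valW"
  have "AE x in lebesgue_on \<omega>. valW (?R z + ?R z') x = valZ (z + z') x"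
    using ae[of z] ae[of z'] sub[OF is_H1_add[OF Z, of z z']] is_H1_add[OF W, of "?R z" "?R z'"]
    by eventually_elim simp
  then show "?R (z + z') = ?R z + ?R z'" by (rule restriction_eqI[OF W])
  have "AE x in lebesgue_on \<omega>. valW (c *\<^sub>R ?R z) x = valZ (c *\<^sub>R z) x"
    using ae[of z] sub[OF is_H1_scaleR[OF Z, of c z]] is_H1_scaleR[OF W, of c "?R z"]
    by eventually_elim simp
  then show "?R (c *\<^sub>R z) = c *\<^sub>R ?R z" by (rule restriction_eqI[OF W])
  show "norm (?R z) \<le> norm z * 1"
    using norm_restriction_le[OF W Z o] by simp
qed

section \<open>Strongly continuous semigroups\<close>

text \<open>Baire category argument: the closed sets \<open>E n\<close> cover the complete space, so
  one of them contains a ball. Subtracting its centre gives a bound at every vector whose norm is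
  the radius, and scaling turns it into an operator bound.\<close>

lemma uniform_boundedness:
  fixes A :: "'i \<Rightarrow> 'a::banach \<Rightarrow>\<^sub>L 'b::real_normed_vector"
  assumes "\<And>x. bounded (range (\<lambda>i. A i x))"
  shows "bounded (range A)"
proof -
  define E where "E n = (\<Inter>i. {x. norm (A i x) \<le> real n})" for n :: nat
  have closed_E: "closed (E n)" for n
    unfolding E_def by (intro closed_INT ballI closed_Collect_le continuous_intros)
  have cover: "(\<Union>n. E n) = UNIV"
  proof (intro equalityI subset_UNIV subsetI)
    fix x
    obtain K where K: "\<And>i. norm (A i x) \<le> K"
      using assms[of x] by (auto simp: bounded_iff)
    obtain n where "K \<le> real n" by (rule real_arch_simple[of K, THEN exE])
    then have "x \<in> E n" unfolding E_def using K by (auto intro: order_trans)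
    then show "x \<in> (\<Union>n. E n)" by blast
  qed
  have "\<exists>n. interior (E n) \<noteq> {}"
  proof (rule ccontr)
    assume "\<nexists>n. interior (E n) \<noteq> {}"
    then have "euclidean interior_of \<Union>(range E) = {}"
      by (intro Baire_category_alt disjI1 completely_metrizable_space_euclidean)
        (use closed_E in auto)
    then show False using cover by simp
  qed
  then obtain n c e where e: "e > 0" and ce: "cball c e \<subseteq> E n"
    by (metis all_not_in_conv mem_interior_cball)
  have bound: "norm (A i x) \<le> (2 * real n / e) * norm x" for i x
  proof (cases "x = 0")
    case False
    define y where "y = (e / norm x) *\<^sub>R x"
    have "norm y = e" using False e by (simp add: y_def)
    then have "c + y \<in> E n" "c \<in> E n" using ce e by (auto simp: subset_eq dist_norm)
    then have "norm (A i (c + y)) \<le> n" "norm (A i c) \<le> n" unfolding E_def by auto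
    moreover have "A i y = A i (c + y) - A i c" by (simp add: blinfun.add_right)
    ultimately have "norm (A i y) \<le> 2 * real n"
      using norm_triangle_ineq4[of "A i (c + y)" "A i c"] by simp
    then have "e / norm x * norm (A i x) \<le> 2 * real n"
      using e by (simp add: y_def blinfun.scaleR_right)
    then show ?thesis using e False by (simp add: field_simps)
  qed simp
  have "norm (A i) \<le> 2 * real n / e" for i
    using e by (intro norm_blinfun_bound bound) simp
  then show ?thesis by (auto simp: bounded_iff)
qed

lemma C0_semigroup_zero: "C0_semigroup S \<Longrightarrow> S 0 x = x"
  unfolding C0_semigroup_def by (metis id_blinfun.rep_eq id_apply)

lemma C0_semigroup_add:
  assumes "C0_semigroup S" "0 \<le> s" "0 \<le> t"
  shows "S (s + t) = S s o\<^sub>L S t"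
  using assms unfolding C0_semigroup_def by blast

lemma C0_semigroup_tendsto: "C0_semigroup S \<Longrightarrow> ((\<lambda>t. S t x) \<longlongrightarrow> x) (at_right 0)"
  unfolding C0_semigroup_def by blast

text \<open>Without a bound near 0 there would be times tending to 0 with unbounded operator norms,
  while strong continuity makes every orbit along them bounded, against
  \<open>uniform_boundedness\<close>. A bound near 0 spreads to \<open>[0, t]\<close> by the
  semigroup law.\<close>

lemma C0_semigroup_locally_bounded:
  fixes S :: "real \<Rightarrow> 'z::banach \<Rightarrow>\<^sub>L 'z"
  assumes S: "C0_semigroup S"
  obtains K where "K \<ge> 1" "\<And>s. 0 \<le> s \<Longrightarrow> s \<le> t \<Longrightarrow> norm (S s) \<le> K"
proof -
  have "\<exists>d>0. \<exists>K. \<forall>s. 0 \<le> s \<and> s \<le> d \<longrightarrow> norm (S s) \<le> K"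
  proof (rule ccontr)
    assume "\<not> ?thesis"
    then have "\<exists>s. 0 \<le> s \<and> s \<le> inverse (real (Suc n)) \<and> norm (S s) > real n" for n
      by (metis inverse_positive_iff_positive linorder_not_le of_nat_0_less_iff zero_less_Suc)
    then obtain h where h: "\<And>n. 0 \<le> h n" "\<And>n. h n \<le> inverse (real (Suc n))"
      "\<And>n. norm (S (h n)) > real n" by metis
    have h0: "h \<longlonglongrightarrow> 0"
      by (rule tendsto_sandwich[OF _ _ tendsto_const LIMSEQ_inverse_real_of_nat]) (use h in auto)
    have "(\<lambda>n. S (h n) x) \<longlonglongrightarrow> x" for x
    proof -
      \<comment> \<open>The chosen times may equal 0, so the limit from the right is first turned
        into continuity at 0 within the closed half-line.\<close>
      have "((\<lambda>s. S s x) \<longlongrightarrow> S 0 x) (at 0 within {0..})"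
        using C0_semigroup_tendsto[OF S] by (simp add: C0_semigroup_zero[OF S] at_within_Ici_at_right)
      then have "continuous (at 0 within {0..}) (\<lambda>s. S s x)"
        by (simp add: continuous_within)
      then have "(\<lambda>n. S (h n) x) \<longlonglongrightarrow> S 0 x"
        by (rule continuous_within_tendsto_compose'[OF _ _ h0]) (use h in auto)
      then show ?thesis by (simp add: C0_semigroup_zero[OF S])
    qed
    then have "bounded (range (\<lambda>n. S (h n) x))" for x
      by (rule convergent_imp_bounded)
    then have "bounded (range (\<lambda>n. S (h n)))" by (rule uniform_boundedness)
    then obtain K where "\<And>n. norm (S (h n)) \<le> K" by (auto simp: bounded_iff)
    moreover obtain n where "K < real n" using reals_Archimedean2 by blast
    ultimately show False using h(3)[of n] by (smt (verit))
  qed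
  then obtain d K where d: "d > 0" and K: "\<And>s. 0 \<le> s \<Longrightarrow> s \<le> d \<Longrightarrow> norm (S s) \<le> K" by blast
  \<comment> \<open>With a base of at least 1 the powers do not decrease, so a time that needs fewer
    steps of length \<open>d\<close> obeys the same bound.\<close>
  define K1 where "K1 = max 1 K"
  have bnd: "norm (S s) \<le> K1 ^ Suc n" if "0 \<le> s" "s \<le> real (Suc n) * d" for s n
    using that
  proof (induction n arbitrary: s)
    case 0
    then show ?case using K[of s] by (simp add: K1_def)
  next
    case (Suc n)
    show ?case
    proof (cases "s \<le> d")
      case True
      have "norm (S s) \<le> K1" using K[of s] True Suc by (simp add: K1_def)
      also have "K1 \<le> K1 ^ Suc (Suc n)" by (rule self_le_power) (auto simp: K1_def)
      finally show ?thesis .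
    next
      case False
      have "S s = S (d + (s - d))" by simp
      also have "\<dots> = S d o\<^sub>L S (s - d)" 
        using d False by (intro C0_semigroup_add[OF S]) auto
      finally have "norm (S s) \<le> norm (S d) * norm (S (s - d))"
        by (simp add: norm_blinfun_compose)
      also have "\<dots> \<le> K1 * K1 ^ Suc n"
        using False Suc d K[of d]
        by (intro mult_mono) (auto simp: K1_def algebra_simps)
      finally show ?thesis by simp
    qed
  qed
  obtain n where n: "t / d \<le> real n" by (rule real_arch_simple[of "t / d", THEN exE])
  show thesis
  proof (rule that)
    show "K1 ^ Suc n \<ge> 1" by (rule one_le_power) (simp add: K1_def)
    fix s assume s: "0 \<le> s" "s \<le> t"
    have "t \<le> real n * d" using n d by (simp add: field_simps)
    also have "\<dots> \<le> real (Suc n) * d" using d by simp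
    finally show "norm (S s) \<le> K1 ^ Suc n" using s by (intro bnd) auto
  qed
qed

text \<open>Setting \<open>S s = I\<close> for negative \<open>s\<close> makes \<open>(t, x) \<mapsto> S t x\<close> continuous, hence
  measurable, on the whole product space.\<close>

definition extended_semigroup :: "(real \<Rightarrow> 'z::real_normed_vector \<Rightarrow>\<^sub>L 'z) \<Rightarrow> bool" where
  "extended_semigroup S \<longleftrightarrow> C0_semigroup S \<and> (\<forall>s\<le>0. S s = id_blinfun)"

text \<open>At negative times the operator is the identity, which \<open>K \<ge> 1\<close> covers;
  hence no lower bound on \<open>s\<close> appears.\<close>

lemma extended_semigroup_bounded:
  fixes S :: "real \<Rightarrow> 'z::banach \<Rightarrow>\<^sub>L 'z"
  assumes "extended_semigroup S"
  obtains K where "K \<ge> 1" "\<And>s x. s \<le> t \<Longrightarrow> norm (S s x) \<le> K * norm x"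
proof -
  obtain K where K: "K \<ge> 1" "\<And>s. 0 \<le> s \<Longrightarrow> s \<le> t \<Longrightarrow> norm (S s) \<le> K"
    using assms unfolding extended_semigroup_def by (metis C0_semigroup_locally_bounded)
  have "norm (S s x) \<le> K * norm x" if "s \<le> t" for s x
  proof (cases "0 \<le> s")
    case True
    have "norm (S s x) \<le> norm (S s) * norm x" by (rule norm_blinfun)
    also have "\<dots> \<le> K * norm x" using K True that by (intro mult_right_mono) auto
    finally show ?thesis .
  next
    case False
    then have "S s x = x" using assms by (simp add: extended_semigroup_def)
    then show ?thesis using K(1) by (simp add: mult_le_cancel_right1)
  qed
  then show thesis using K that by blast
qed

text \<open>Joint continuity follows from strong continuity at 0 once the operators are uniformly
  bounded for times up to some \<open>a\<close>: moving the vector costs a factor \<open>K\<close>,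
  and moving the time is reduced to an increment at 0.\<close>

lemma extended_semigroup_continuous:
  fixes S :: "real \<Rightarrow> 'z::banach \<Rightarrow>\<^sub>L 'z"
  assumes S: "extended_semigroup S"
  shows "continuous_on UNIV (\<lambda>p. S (fst p) (snd p))"
proof -
  have C0: "C0_semigroup S" and id: "\<And>s x. s \<le> 0 \<Longrightarrow> S s x = x"
    using S by (auto simp: extended_semigroup_def)
  have lim0: "((\<lambda>h. S h x) \<longlongrightarrow> x) (at 0)" for x
  proof (rule filterlim_split_at)
    show "((\<lambda>h. S h x) \<longlongrightarrow> x) (at_right 0)" using C0 by (rule C0_semigroup_tendsto)
    show "((\<lambda>h. S h x) \<longlongrightarrow> x) (at_left 0)"
      by (rule tendsto_eventually) (auto simp: eventually_at_left_field id intro: exI[of _ "-1"])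
  qed
  \<comment> \<open>The smaller of the two times, clamped at 0, is factored out and bounded by
    \<open>K\<close>; what remains is the orbit at the distance of the clamped times.\<close>
  have diff: "norm (S t x - S s x) \<le> K * norm (S \<bar>max 0 t - max 0 s\<bar> x - x)"
    if K: "\<And>r y. r \<le> a \<Longrightarrow> norm (S r y) \<le> K * norm y" and "s \<le> a" "t \<le> a" "0 \<le> a"
    for s t x a K
  proof -
    have *: "norm (S t x - S s x) \<le> K * norm (S (t - s) x - x)"
      if "0 \<le> s" "s \<le> t" "s \<le> a" for s t
    proof -
      have "S t x = S s (S (t - s) x)"
        using C0_semigroup_add[OF C0, of s "t - s"] that by simp
      then have "S t x - S s x = S s (S (t - s) x - x)" by (simp only: blinfun.diff_right)
      then show ?thesis using K(1) that by simp
    qed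
    have max: "S r x = S (max 0 r) x" for r by (cases "r \<le> 0") (auto simp: id)
    show ?thesis
      unfolding max[of s] max[of t]
    proof (cases "max 0 s \<le> max 0 t")
      case True
      then show "norm (S (max 0 t) x - S (max 0 s) x) \<le> K * norm (S \<bar>max 0 t - max 0 s\<bar> x - x)"
        using *[of "max 0 s" "max 0 t"] that by simp
    next
      case False
      then have "\<bar>max 0 t - max 0 s\<bar> = max 0 s - max 0 t" by linarith
      then show "norm (S (max 0 t) x - S (max 0 s) x) \<le> K * norm (S \<bar>max 0 t - max 0 s\<bar> x - x)"
        using *[of "max 0 t" "max 0 s"] that False by (simp only: norm_minus_commute)
    qed
  qed
  have "isCont (\<lambda>p. S (fst p) (snd p)) (s, x)" for s x
  proof -
    \<comment> \<open>The margin 1 keeps all times near \<open>s\<close> below \<open>a\<close>, so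
      that one constant \<open>K\<close> works on a whole neighbourhood.\<close>
    define a where "a = \<bar>s\<bar> + 1"
    obtain K where K: "K \<ge> 1" "\<And>r y. r \<le> a \<Longrightarrow> norm (S r y) \<le> K * norm y"
      using extended_semigroup_bounded[OF S] by blast
    define g where "g p = K * norm (snd p - x) + K * norm (S \<bar>max 0 (fst p) - max 0 s\<bar> x - x)" for p
    have "isCont (\<lambda>h. S h x) 0" using lim0 id by (simp add: isCont_def)
    moreover have "((\<lambda>p. \<bar>max 0 (fst p) - max 0 s\<bar>) \<longlongrightarrow> \<bar>max 0 (fst (s, x)) - max 0 s\<bar>) (at (s, x))"
      by (intro tendsto_intros)
    ultimately have "((\<lambda>p. S \<bar>max 0 (fst p) - max 0 s\<bar> x) \<longlongrightarrow> S 0 x) (at (s, x))"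
      by (intro isCont_tendsto_compose[where g = "\<lambda>h. S h x"]) simp_all
    then have "(g \<longlongrightarrow> K * norm (snd (s, x) - x) + K * norm (S 0 x - x)) (at (s, x))"
      unfolding g_def
      by (intro tendsto_add tendsto_mult tendsto_const tendsto_norm tendsto_diff tendsto_snd tendsto_ident_at)
    then have g0: "(g \<longlongrightarrow> 0) (at (s, x))" by (simp add: id)
    have "((\<lambda>p. fst p) \<longlongrightarrow> fst (s, x)) (at (s, x))"
      by (intro tendsto_fst tendsto_ident_at)
    then have ev: "\<forall>\<^sub>F p in at (s, x). fst p < a"
      by (rule order_tendstoD(2)) (simp add: a_def)
    have "((\<lambda>p. S (fst p) (snd p) - S s x) \<longlongrightarrow> 0) (at (s, x))"
    proof (rule Lim_null_comparison[OF _ g0])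
      show "\<forall>\<^sub>F p in at (s, x). norm (S (fst p) (snd p) - S s x) \<le> g p"
        using ev
      proof eventually_elim
        case (elim p)
        have "S (fst p) (snd p) - S s x = S (fst p) (snd p - x) + (S (fst p) x - S s x)"
          by (simp add: blinfun.diff_right)
        also have "norm \<dots> \<le> K * norm (snd p - x) + K * norm (S \<bar>max 0 (fst p) - max 0 s\<bar> x - x)"
          using elim by (intro norm_triangle_mono K diff[OF K(2)]) (auto simp: a_def)
        finally show ?case by (simp add: g_def)
      qed
    qed
    then show ?thesis by (simp add: isCont_def LIM_zero_iff)
  qed
  then show ?thesis by (auto simp: continuous_on_eq_continuous_at)
qed

text \<open>Clamping extends any given semigroup: the semigroup axioms concern nonnegative times
  only, where nothing changes.\<close>

lemma extended_semigroup_max: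
  assumes "C0_semigroup S"
  shows "extended_semigroup (\<lambda>s. S (max 0 s))"
proof -
  have S0: "S 0 = id_blinfun" using assms unfolding C0_semigroup_def by blast
  have "((\<lambda>t. S (max 0 t) x) \<longlongrightarrow> x) (at_right 0)" for x
    by (rule Lim_transform_eventually[OF C0_semigroup_tendsto[OF assms]])
      (auto simp: eventually_at_filter)
  moreover have "S (max 0 (s + t)) = S (max 0 s) o\<^sub>L S (max 0 t)" if "0 \<le> s" "0 \<le> t" for s t
    using C0_semigroup_add[OF assms that] that by simp
  ultimately show ?thesis
    unfolding extended_semigroup_def C0_semigroup_def by (auto simp: S0 max_absorb1)
qed

text \<open>The difference quotients are taken at positive times, where clamping has no effect, so
  domain and generator survive.\<close>

lemma generates_max:
  assumes "generates D A S"
  shows "generates D A (\<lambda>s. S (max 0 s))"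
proof -
  have "((\<lambda>h. (S (max 0 h) x - x) /\<^sub>R h) \<longlongrightarrow> y) (at_right 0)
      \<longleftrightarrow> ((\<lambda>h. (S h x - x) /\<^sub>R h) \<longlongrightarrow> y) (at_right 0)" for x y
    by (rule filterlim_cong) (auto simp: eventually_at_filter)
  moreover have "C0_semigroup (\<lambda>s. S (max 0 s))"
    using assms extended_semigroup_max[of S] unfolding generates_def extended_semigroup_def by blast
  ultimately show ?thesis using assms unfolding generates_def by simp
qed

section \<open>Measurability, limits and derivatives along orbits\<close>

lemma extended_semigroup_measurable:
  fixes S :: "real \<Rightarrow> 'z::{banach,second_countable_topology} \<Rightarrow>\<^sub>L 'z"
  assumes "extended_semigroup S" "g \<in> borel_measurable M" "f \<in> borel_measurable M"
  shows "(\<lambda>x. S (g x) (f x)) \<in> borel_measurable M"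
  using borel_measurable_continuous_Pair[OF assms(2,3) extended_semigroup_continuous[OF assms(1)]] .

lemma extended_semigroup_continuous_on:
  fixes S :: "real \<Rightarrow> 'z::banach \<Rightarrow>\<^sub>L 'z"
  assumes "extended_semigroup S" "continuous_on X g" "continuous_on X f"
  shows "continuous_on X (\<lambda>x. S (g x) (f x))"
  using continuous_on_compose2[OF extended_semigroup_continuous[OF assms(1)]
      continuous_on_Pair[OF assms(2,3)]] by simp

lemma extended_semigroup_tendsto:
  fixes S :: "real \<Rightarrow> 'z::banach \<Rightarrow>\<^sub>L 'z"
  assumes "extended_semigroup S" "(g \<longlongrightarrow> t) F" "(f \<longlongrightarrow> x) F"
  shows "((\<lambda>h. S (g h) (f h)) \<longlongrightarrow> S t x) F"
proof -
  have "isCont (\<lambda>p. S (fst p) (snd p)) (t, x)"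
    using extended_semigroup_continuous[OF assms(1)]
    by (auto simp: continuous_on_eq_continuous_at)
  from isCont_tendsto_compose[OF this tendsto_Pair[OF assms(2,3)]] show ?thesis by simp
qed

text \<open>Vector quotients let limits pass directly through semigroup operators. The quotient by
  \<open>s - t\<close> and the one by its absolute value in the derivative differ only by a sign,
  which the norm removes.\<close>

lemma has_vector_derivative_iff_quotient:
  fixes f :: "real \<Rightarrow> 'a::real_normed_vector"
  shows "(f has_vector_derivative y) (at t within X) \<longleftrightarrow>
    ((\<lambda>s. (f s - f t) /\<^sub>R (s - t)) \<longlongrightarrow> y) (at t within X)"
proof -
  have "norm ((f s - f t) /\<^sub>R (s - t) - y)
      = norm ((f s - (f t + (s - t) *\<^sub>R y)) /\<^sub>R norm (s - t))" if "s \<noteq> t" for s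
  proof -
    have "(f s - f t) /\<^sub>R (s - t) - y = (f s - (f t + (s - t) *\<^sub>R y)) /\<^sub>R (s - t)"
      using that by (simp add: scaleR_diff_right scaleR_add_right)
    then show ?thesis by simp
  qed
  then have "\<forall>\<^sub>F s in at t within X. norm ((f s - f t) /\<^sub>R (s - t) - y)
      = norm ((f s - (f t + (s - t) *\<^sub>R y)) /\<^sub>R norm (s - t))"
    by (simp add: eventually_at_filter)
  then have "((\<lambda>s. norm ((f s - f t) /\<^sub>R (s - t) - y)) \<longlongrightarrow> 0) (at t within X) \<longleftrightarrow>
      ((\<lambda>s. norm ((f s - (f t + (s - t) *\<^sub>R y)) /\<^sub>R norm (s - t))) \<longlongrightarrow> 0) (at t within X)"
    by (rule tendsto_cong)
  then show ?thesis
    unfolding has_vector_derivative_def has_derivative_within tendsto_norm_zero_iff LIM_zero_iff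
    by (auto simp: bounded_linear_scaleR_left divide_inverse_commute)
qed

lemma generates_quotient_tendsto:
  fixes S :: "real \<Rightarrow> 'z::real_normed_vector \<Rightarrow>\<^sub>L 'z"
  shows "generates D A S \<Longrightarrow> x \<in> D \<Longrightarrow> ((\<lambda>h. (S h x - x) /\<^sub>R h) \<longlongrightarrow> A x) (at_right 0)"
  unfolding generates_def by blast

text \<open>The bounded operator \<open>S t\<close> may be applied to the difference quotient of
  \<open>x\<close> and commutes with \<open>S h\<close>; this produces the quotient of
  \<open>S t x\<close> together with its limit.\<close>

lemma generates_semigroup_invariant:
  fixes S :: "real \<Rightarrow> 'z::real_normed_vector \<Rightarrow>\<^sub>L 'z"
  assumes gen: "generates D A S" and x: "x \<in> D" and t: "0 \<le> t"
  shows "S t x \<in> D" and "A (S t x) = S t (A x)"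
proof -
  have C0: "C0_semigroup S" using gen unfolding generates_def by blast
  have "((\<lambda>h. S t ((S h x - x) /\<^sub>R h)) \<longlongrightarrow> S t (A x)) (at_right 0)"
    by (intro blinfun.tendsto tendsto_const generates_quotient_tendsto[OF gen x])
  moreover have "\<forall>\<^sub>F h in at_right 0. S t ((S h x - x) /\<^sub>R h) = (S h (S t x) - S t x) /\<^sub>R h"
    unfolding eventually_at_right_field
  proof (intro exI[of _ 1] conjI allI impI)
    fix h :: real assume h: "0 < h"
    have "S t o\<^sub>L S h = S h o\<^sub>L S t"
      using C0_semigroup_add[OF C0 t, of h] C0_semigroup_add[OF C0 _ t, of h] h
      by (simp add: add.commute)
    then have "S t (S h x) = S h (S t x)"
      by (metis blinfun_apply_blinfun_compose)
    then show "S t ((S h x - x) /\<^sub>R h) = (S h (S t x) - S t x) /\<^sub>R h"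
      by (simp add: blinfun.diff_right blinfun.scaleR_right)
  qed simp
  ultimately have lim: "((\<lambda>h. (S h (S t x) - S t x) /\<^sub>R h) \<longlongrightarrow> S t (A x)) (at_right 0)"
    by (rule Lim_transform_eventually)
  then show "S t x \<in> D" using gen unfolding generates_def by blast
  from generates_quotient_tendsto[OF gen this] lim
  show "A (S t x) = S t (A x)" by (rule tendsto_unique[rotated]) simp
qed

text \<open>Generation gives only a right-hand derivative at 0. Factoring out the operator at the
  smaller time, \<open>S (min s t)\<close>, treats both sides of \<open>t\<close> at once, and joint
  continuity handles the moving operator.\<close>

lemma generates_orbit_derivative:
  fixes S :: "real \<Rightarrow> 'z::banach \<Rightarrow>\<^sub>L 'z"
  assumes gen: "generates D A S" and ext: "extended_semigroup S" and x: "x \<in> D" and t: "0 \<le> t"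
  shows "((\<lambda>s. S s x) has_vector_derivative S t (A x)) (at t within {0..})"
proof -
  have C0: "C0_semigroup S" using gen unfolding generates_def by blast
  define q where "q s = (S \<bar>s - t\<bar> x - x) /\<^sub>R \<bar>s - t\<bar>" for s
  have "filterlim (\<lambda>s. \<bar>s - t\<bar>) (at_right 0) (at t within {0..})"
    unfolding filterlim_at
    by (intro conjI tendsto_eq_intros) (auto simp: eventually_at_filter)
  then have q: "(q \<longlongrightarrow> A x) (at t within {0..})"
    unfolding q_def by (rule filterlim_compose[OF generates_quotient_tendsto[OF gen x]])
  have "((\<lambda>s. S (min s t) (q s)) \<longlongrightarrow> S t (A x)) (at t within {0..})"
    by (intro extended_semigroup_tendsto[OF ext] q tendsto_eq_intros) auto
  moreover have "\<forall>\<^sub>F s in at t within {0..}. S (min s t) (q s) = (S s x - S t x) /\<^sub>R (s - t)"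
    unfolding eventually_at_filter
  proof (intro always_eventually allI impI)
    fix s assume s: "s \<noteq> t" "s \<in> {0..}"
    show "S (min s t) (q s) = (S s x - S t x) /\<^sub>R (s - t)"
    proof (cases "s < t")
      case True
      have "S t x = S s (S (t - s) x)"
        using C0_semigroup_add[OF C0, of s "t - s"] s True by simp
      then have "S s (S (t - s) x - x) = - (S s x - S t x)"
        by (simp only: blinfun.diff_right minus_diff_eq)
      \<comment> \<open>For \<open>s < t\<close> the quotient \<open>q\<close> divides by
        \<open>t - s\<close>; this sign change cancels the one in the numerator.\<close>
      moreover have "S (min s t) (q s) = - inverse (s - t) *\<^sub>R S s (S (t - s) x - x)"
      proof -
        have "\<bar>s - t\<bar> = t - s" "min s t = s" "- inverse (s - t) = inverse (t - s)"
          using True inverse_minus_eq[of "s - t"] by simp_all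
        then show ?thesis by (simp only: q_def blinfun.scaleR_right)
      qed
      ultimately show ?thesis by (simp flip: scaleR_minus_right)
    next
      case False
      have "S s x = S t (S (s - t) x)"
        using C0_semigroup_add[OF C0, of t "s - t"] s t False by simp
      then have "S t (S (s - t) x - x) = S s x - S t x" by (simp only: blinfun.diff_right)
      then show ?thesis using False
        by (simp add: q_def blinfun.scaleR_right min_def)
    qed
  qed
  ultimately have "((\<lambda>s. (S s x - S t x) /\<^sub>R (s - t)) \<longlongrightarrow> S t (A x)) (at t within {0..})"
    by (rule Lim_transform_eventually)
  then show ?thesis
    by (simp add: has_vector_derivative_iff_quotient)
qed

section \<open>Variation of constants\<close>

lemma set_integrable_lebesgue_continuous:
  fixes f :: "real \<Rightarrow> 'a::{banach,second_countable_topology}"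
  assumes "continuous_on {a..b} f"
  shows "set_integrable lebesgue {a..b} f"
  using borel_integrable_atLeastAtMost'[OF assms] integrable_completion[of _ lborel]
  unfolding set_integrable_def by (metis borel_measurable_integrable)

text \<open>Pairing with a fixed vector \<open>y\<close> reduces the claim to real functions, for
  which the Lebesgue integral is the gauge integral; a vector is determined by these
  pairings.\<close>

lemma fundamental_theorem_of_calculus_bochner:
  fixes f :: "real \<Rightarrow> 'a::{real_inner,banach,second_countable_topology}"
  assumes ab: "a \<le> b" and cont: "continuous_on {a..b} f'"
    and deriv: "\<And>x. x \<in> {a..b} \<Longrightarrow> (f has_vector_derivative f' x) (at x within {a..b})"
  shows "(LINT x:{a..b}|lebesgue. f' x) = f b - f a"
proof -
  have "(LINT x:{a..b}|lebesgue. f' x) \<bullet> y = (f b - f a) \<bullet> y" for y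
  proof -
    have "(LINT x:{a..b}|lebesgue. f' x) \<bullet> y = (LINT x:{a..b}|lebesgue. f' x \<bullet> y)"
      using set_integrable_lebesgue_continuous[OF cont]
      unfolding set_lebesgue_integral_def set_integrable_def
      by (simp flip: integral_inner_left)
    also have "\<dots> = integral {a..b} (\<lambda>x. f' x \<bullet> y)"
      using set_integrable_lebesgue_continuous[of a b "\<lambda>x. f' x \<bullet> y"] cont
      by (intro set_lebesgue_integral_eq_integral) (simp add: continuous_on_inner)
    also have "\<dots> = f b \<bullet> y - f a \<bullet> y"
      by (intro integral_unique fundamental_theorem_of_calculus[OF ab]
          bounded_linear.has_vector_derivative[OF bounded_linear_inner_left] deriv)
    finally show ?thesis by (simp add: inner_diff_left)
  qed
  then show ?thesis by (metis vector_eq_rdot)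
qed

text \<open>A product rule for two strongly continuous factors: the inner derivative contributes
  \<open>P A\<close>, the outer one \<open>- L P\<close>, and the commutation hypothesis replaces
  their difference by \<open>Q\<close>.\<close>

lemma duhamel_on_domain:
  fixes S :: "real \<Rightarrow> 'z::banach \<Rightarrow>\<^sub>L 'z"
    and R :: "real \<Rightarrow> 'w::{real_inner,banach,second_countable_topology} \<Rightarrow>\<^sub>L 'w"
    and P Q :: "'z \<Rightarrow>\<^sub>L 'w"
  assumes S: "generates D A S" "extended_semigroup S"
    and R: "generates E L R" "extended_semigroup R"
    and PD: "\<And>x. x \<in> D \<Longrightarrow> P x \<in> E"
    and comm: "\<And>x. x \<in> D \<Longrightarrow> P (A x) - L (P x) = Q x"
    and x: "x \<in> D" and r: "r \<le> t"
  shows "(LINT \<sigma>:{r..t}|lebesgue. R (t - \<sigma>) (Q (S (\<sigma> - r) x))) = P (S (t - r) x) - R (t - r) (P x)"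
proof -
  define f where "f \<sigma> = R (t - \<sigma>) (P (S (\<sigma> - r) x))" for \<sigma>
  have id: "R 0 y = y" "S 0 x = x" for y
    using S R by (auto simp: extended_semigroup_def)
  have "(LINT \<sigma>:{r..t}|lebesgue. R (t - \<sigma>) (Q (S (\<sigma> - r) x))) = f t - f r"
  proof (rule fundamental_theorem_of_calculus_bochner[OF r])
    show "continuous_on {r..t} (\<lambda>\<sigma>. R (t - \<sigma>) (Q (S (\<sigma> - r) x)))"
      by (intro extended_semigroup_continuous_on[OF R(2)] extended_semigroup_continuous_on[OF S(2)]
          blinfun.continuous_on continuous_intros)
    fix s assume s: "s \<in> {r..t}"
    \<comment> \<open>By invariance \<open>y\<close> lies in \<open>D\<close>, hence
      \<open>P y\<close> in \<open>E\<close>, so both orbits are differentiable here.\<close>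
    define y where "y = S (s - r) x"
    have y: "y \<in> D" and Ay: "A y = S (s - r) (A x)"
      unfolding y_def using generates_semigroup_invariant[OF S(1) x, of "s - r"] s by auto
    have "((\<lambda>\<sigma>. S (\<sigma> - r) x) has_vector_derivative A y) (at s within {r..t})"
    proof -
      have "((\<lambda>s. S s x) has_vector_derivative A y) (at (s - r) within (\<lambda>\<sigma>. \<sigma> - r) ` {r..t})"
        unfolding Ay using s
        by (intro has_vector_derivative_within_subset[OF generates_orbit_derivative[OF S x]]) auto
      moreover have "((\<lambda>\<sigma>. \<sigma> - r) has_vector_derivative 1) (at s within {r..t})"
        by (auto intro!: derivative_eq_intros)
      ultimately show ?thesis
        using vector_diff_chain_within[of "\<lambda>\<sigma>. \<sigma> - r" 1 s "{r..t}" "\<lambda>s. S s x" "A y"] by (simp add: o_def)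
    qed
    then have "((\<lambda>\<sigma>. (S (\<sigma> - r) x - S (s - r) x) /\<^sub>R (\<sigma> - s)) \<longlongrightarrow> A y) (at s within {r..t})"
      by (simp only: has_vector_derivative_iff_quotient)
    \<comment> \<open>First half of the increment: the inner vector moves while the outer operator
      is already taken at the new time \<sigma>, so the limit uses joint continuity.\<close>
    then have 1: "((\<lambda>\<sigma>. R (t - \<sigma>) (P ((S (\<sigma> - r) x - S (s - r) x) /\<^sub>R (\<sigma> - s)))) \<longlongrightarrow> R (t - s) (P (A y)))
        (at s within {r..t})"
      by (intro extended_semigroup_tendsto[OF R(2)] blinfun.tendsto tendsto_intros)
    have "((\<lambda>\<sigma>. R (t - \<sigma>) (P y)) has_vector_derivative - R (t - s) (L (P y))) (at s within {r..t})"
    proof -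
      have "((\<lambda>s. R s (P y)) has_vector_derivative R (t - s) (L (P y)))
          (at (t - s) within (\<lambda>\<sigma>. t - \<sigma>) ` {r..t})"
        using s
        by (intro has_vector_derivative_within_subset[OF generates_orbit_derivative[OF R PD[OF y]]]) auto
      moreover have "((\<lambda>\<sigma>. t - \<sigma>) has_vector_derivative - 1) (at s within {r..t})"
        by (auto intro!: derivative_eq_intros)
      ultimately show ?thesis
        using vector_diff_chain_within[of "\<lambda>\<sigma>. t - \<sigma>" "- 1" s "{r..t}" "\<lambda>s. R s (P y)" "R (t - s) (L (P y))"]
        by (simp add: o_def)
    qed
    then have 2: "((\<lambda>\<sigma>. (R (t - \<sigma>) (P y) - R (t - s) (P y)) /\<^sub>R (\<sigma> - s))
        \<longlongrightarrow> - R (t - s) (L (P y))) (at s within {r..t})"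
      by (simp only: has_vector_derivative_iff_quotient)
    have "((\<lambda>\<sigma>. (f \<sigma> - f s) /\<^sub>R (\<sigma> - s)) \<longlongrightarrow> R (t - s) (P (A y)) + (- R (t - s) (L (P y))))
        (at s within {r..t})"
      using tendsto_add[OF 1 2]
      by (simp add: f_def y_def blinfun.diff_right blinfun.scaleR_right flip: scaleR_add_right)
    also have "R (t - s) (P (A y)) + (- R (t - s) (L (P y))) = R (t - s) (Q y)"
      by (simp flip: comm[OF y] add: blinfun.diff_right)
    finally show "(f has_vector_derivative R (t - s) (Q (S (s - r) x))) (at s within {r..t})"
      unfolding y_def by (simp only: has_vector_derivative_iff_quotient)
  qed
  then show ?thesis by (simp add: f_def id)
qed

text \<open>Both sides depend continuously on \<open>x\<close>, so the identity passes from the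
  dense set \<open>D\<close> to the whole space; under the integral this is dominated convergence on
  a bounded interval.\<close>

lemma duhamel:
  fixes S :: "real \<Rightarrow> 'z::banach \<Rightarrow>\<^sub>L 'z"
    and R :: "real \<Rightarrow> 'w::{real_inner,banach,second_countable_topology} \<Rightarrow>\<^sub>L 'w"
    and P Q :: "'z \<Rightarrow>\<^sub>L 'w"
  assumes S: "generates D A S" "extended_semigroup S"
    and R: "generates E L R" "extended_semigroup R"
    and PD: "\<And>x. x \<in> D \<Longrightarrow> P x \<in> E"
    and comm: "\<And>x. x \<in> D \<Longrightarrow> P (A x) - L (P x) = Q x"
    and dense: "closure D = UNIV" and r: "r \<le> t"
  shows "(LINT \<sigma>:{r..t}|lebesgue. R (t - \<sigma>) (Q (S (\<sigma> - r) x))) = P (S (t - r) x) - R (t - r) (P x)"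
proof -
  obtain X where X: "\<And>n. X n \<in> D" "X \<longlonglongrightarrow> x"
    using dense closure_sequential by blast
  obtain K where K: "K \<ge> 1" "\<And>s y. s \<le> t - r \<Longrightarrow> norm (S s y) \<le> K * norm y"
    using extended_semigroup_bounded[OF S(2)] by blast
  obtain K' where K': "K' \<ge> 1" "\<And>s y. s \<le> t - r \<Longrightarrow> norm (R s y) \<le> K' * norm y"
    using extended_semigroup_bounded[OF R(2)] by blast
  obtain C where C: "\<And>n. norm (X n) \<le> C"
    using convergent_imp_bounded[OF X(2)] by (auto simp: bounded_iff)
  have cont: "continuous_on {r..t} (\<lambda>\<sigma>. R (t - \<sigma>) (Q (S (\<sigma> - r) x)))" for x
    by (intro extended_semigroup_continuous_on[OF R(2)] extended_semigroup_continuous_on[OF S(2)]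
        blinfun.continuous_on continuous_intros)
  have "(\<lambda>n. LINT \<sigma>:{r..t}|lebesgue. R (t - \<sigma>) (Q (S (\<sigma> - r) (X n))))
      \<longlonglongrightarrow> (LINT \<sigma>:{r..t}|lebesgue. R (t - \<sigma>) (Q (S (\<sigma> - r) x)))"
    unfolding set_lebesgue_integral_def
  proof (rule integral_dominated_convergence)
    show "(\<lambda>\<sigma>. indicator {r..t} \<sigma> *\<^sub>R R (t - \<sigma>) (Q (S (\<sigma> - r) (X n)))) \<in> borel_measurable lebesgue" for n
      using set_integrable_lebesgue_continuous[OF cont] unfolding set_integrable_def by auto
    show "(\<lambda>\<sigma>. indicator {r..t} \<sigma> *\<^sub>R R (t - \<sigma>) (Q (S (\<sigma> - r) x))) \<in> borel_measurable lebesgue"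
      using set_integrable_lebesgue_continuous[OF cont] unfolding set_integrable_def by auto
    \<comment> \<open>The majorant is constant on \<open>[r, t]\<close>: it multiplies the bounds
      for \<open>R\<close>, \<open>Q\<close>, \<open>S\<close> and for the approximating
      sequence.\<close>
    show "integrable lebesgue (\<lambda>\<sigma>. indicator {r..t} \<sigma> *\<^sub>R (K' * (norm Q * (K * C))))"
      using set_integrable_lebesgue_continuous[of r t "\<lambda>_. K' * (norm Q * (K * C))"]
      by (simp add: set_integrable_def)
    show "AE \<sigma> in lebesgue. (\<lambda>n. indicator {r..t} \<sigma> *\<^sub>R R (t - \<sigma>) (Q (S (\<sigma> - r) (X n))))
        \<longlonglongrightarrow> indicator {r..t} \<sigma> *\<^sub>R R (t - \<sigma>) (Q (S (\<sigma> - r) x))"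
      by (intro AE_I2 tendsto_intros blinfun.tendsto X)
    show "AE \<sigma> in lebesgue. norm (indicator {r..t} \<sigma> *\<^sub>R R (t - \<sigma>) (Q (S (\<sigma> - r) (X n))))
        \<le> indicator {r..t} \<sigma> *\<^sub>R (K' * (norm Q * (K * C)))" for n
    proof (rule AE_I2)
      fix \<sigma>
      have "norm (R (t - \<sigma>) (Q (S (\<sigma> - r) (X n)))) \<le> K' * (norm Q * (K * C))" if "\<sigma> \<in> {r..t}"
        using that K(1) K'(1) C[of n]
        by (intro order_trans[OF K'(2)] mult_left_mono order_trans[OF norm_blinfun]
            order_trans[OF K(2)]) auto
      then show "norm (indicator {r..t} \<sigma> *\<^sub>R R (t - \<sigma>) (Q (S (\<sigma> - r) (X n))))
        \<le> indicator {r..t} \<sigma> *\<^sub>R (K' * (norm Q * (K * C)))"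
        by (auto simp: indicator_def)
    qed
  qed
  moreover have "(\<lambda>n. LINT \<sigma>:{r..t}|lebesgue. R (t - \<sigma>) (Q (S (\<sigma> - r) (X n))))
      \<longlonglongrightarrow> P (S (t - r) x) - R (t - r) (P x)"
  proof -
    have eq: "(LINT \<sigma>:{r..t}|lebesgue. R (t - \<sigma>) (Q (S (\<sigma> - r) (X n))))
        = P (S (t - r) (X n)) - R (t - r) (P (X n))" for n
      by (rule duhamel_on_domain[OF S R _ _ X(1) r]) (use PD comm in auto)
    show ?thesis unfolding eq by (intro tendsto_diff blinfun.tendsto tendsto_const X)
  qed
  ultimately show ?thesis by (rule LIMSEQ_unique)
qed

section \<open>Mild solutions over a fixed time interval\<close>

lemma set_integral_eq_lebesgue_on:
  fixes f :: "real \<Rightarrow> 'a::{banach,second_countable_topology}"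
  assumes "A \<in> sets lebesgue" "B \<in> sets lebesgue" "A \<subseteq> B"
  shows "(LINT x:A|lebesgue. f x) = (LINT x|lebesgue_on B. indicator A x *\<^sub>R f x)"
proof -
  have "indicator A x *\<^sub>R f x = indicator B x *\<^sub>R indicator A x *\<^sub>R f x" for x
    using assms(3) by (auto simp: indicator_def)
  then have "(LINT x:A|lebesgue. f x) = (LINT x|lebesgue. indicator B x *\<^sub>R indicator A x *\<^sub>R f x)"
    unfolding set_lebesgue_integral_def by presburger
  then show ?thesis
    using assms(2) by (simp only: integral_lebesgue_on)
qed

text \<open>The values at all times \<open>s \<le> t\<close> become integrals over one finite
  measure space, with the upper limit moved into an indicator; this prepares the double integral for
  Fubini.\<close>

lemma mild_solution_eq_lebesgue_on:
  assumes "0 \<le> s" "s \<le> t"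
  shows "mild_solution S x0 f s = S s x0 + (LINT r|lebesgue_on {0..t}. indicator {..s} r *\<^sub>R S (s - r) (f r))"
proof -
  have "(LINT r:{0..s}|lebesgue. S (s - r) (f r))
      = (LINT r|lebesgue_on {0..t}. indicator {0..s} r *\<^sub>R S (s - r) (f r))"
    using assms by (intro set_integral_eq_lebesgue_on) auto
  also have "\<dots> = (LINT r|lebesgue_on {0..t}. indicator {..s} r *\<^sub>R S (s - r) (f r))"
    by (intro Bochner_Integration.integral_cong) (auto simp: indicator_def)
  finally show ?thesis by (simp add: mild_solution_def)
qed

text \<open>Duhamel's formula under the integral produces a double integral over the triangle
  \<open>r \<le> \<sigma>\<close>. The second solution contains the same double integral in the
  opposite order, so after cancellation only the initial values survive.\<close>

lemma mild_solution_error: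
  fixes S :: "real \<Rightarrow> 'z::{banach,second_countable_topology} \<Rightarrow>\<^sub>L 'z"
    and R :: "real \<Rightarrow> 'w::{real_inner,banach,second_countable_topology} \<Rightarrow>\<^sub>L 'w"
    and P Q :: "'z \<Rightarrow>\<^sub>L 'w"
  assumes S: "generates D A S" "extended_semigroup S"
    and R: "generates E L R" "extended_semigroup R"
    and PD: "\<And>x. x \<in> D \<Longrightarrow> P x \<in> E"
    and comm: "\<And>x. x \<in> D \<Longrightarrow> P (A x) - L (P x) = Q x"
    and dense: "closure D = UNIV" and t: "0 \<le> t"
    and f: "integrable (lebesgue_on {0..t}) f"
  shows "P (mild_solution S z0 f t) - mild_solution R w0 (\<lambda>\<tau>. P (f \<tau>) + Q (mild_solution S z0 f \<tau>)) t
    = R t (P z0 - w0)"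
proof -
  define M where "M = lebesgue_on {0..t}"
  interpret M: finite_measure M
    unfolding M_def by (rule finite_measure_lebesgue_on) auto
  interpret MM: pair_sigma_finite M M ..
  have f_M [measurable]: "f \<in> borel_measurable M" and f_int: "integrable M f"
    using f by (auto simp: M_def)
  have id_M [measurable]: "(\<lambda>x. x) \<in> borel_measurable M"
    unfolding M_def by (intro measurable_restrict_space1 measurable_completion) simp
  have space_M: "space M = {0..t}" by (simp add: M_def)
  obtain K where K: "K \<ge> 1" "\<And>s y. s \<le> t \<Longrightarrow> norm (S s y) \<le> K * norm y"
    using extended_semigroup_bounded[OF S(2)] by blast
  obtain K' where K': "K' \<ge> 1" "\<And>s y. s \<le> t \<Longrightarrow> norm (R s y) \<le> K' * norm y"
    using extended_semigroup_bounded[OF R(2)] by blast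
  have blin_meas: "(\<lambda>x. U (g x)) \<in> borel_measurable N" if "g \<in> borel_measurable N"
    for U :: "'z \<Rightarrow>\<^sub>L 'w" and g and N :: "'n measure"
    by (rule borel_measurable_continuous_on[OF _ that]) (intro blinfun.continuous_on continuous_intros)
  note S_meas = extended_semigroup_measurable[OF S(2)]
  note R_meas = extended_semigroup_measurable[OF R(2)]

  \<comment> \<open>The integrand of Duhamel's formula, cut off to the triangle
    \<open>r \<le> \<sigma>\<close>; \<open>r\<close> is the time at which \<open>f\<close>
    acts.\<close>
  define k where "k \<sigma> r = indicator {..\<sigma>} r *\<^sub>R R (t - \<sigma>) (Q (S (\<sigma> - r) (f r)))" for \<sigma> r :: real
  have Sf: "integrable M (\<lambda>r. indicator {..s} r *\<^sub>R S (s - r) (f r))" if "s \<le> t" for s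
  proof (rule Bochner_Integration.integrable_bound)
    show "integrable M (\<lambda>r. K * norm (f r))" using f_int by simp
    show "(\<lambda>r. indicator {..s} r *\<^sub>R S (s - r) (f r)) \<in> borel_measurable M"
      by (intro borel_measurable_scaleR S_meas) measurable
    show "AE r in M. norm (indicator {..s} r *\<^sub>R S (s - r) (f r)) \<le> norm (K * norm (f r))"
      using K that by (intro AE_I2) (auto simp: indicator_def space_M)
  qed
  have z: "mild_solution S z0 f s = S s z0 + (LINT r|M. indicator {..s} r *\<^sub>R S (s - r) (f r))"
    if "s \<in> {0..t}" for s
    using that unfolding M_def by (intro mild_solution_eq_lebesgue_on) auto
  have k_int: "integrable (M \<Otimes>\<^sub>M M) (\<lambda>(\<sigma>, r). k \<sigma> r)"
  proof (rule Bochner_Integration.integrable_bound)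
    \<comment> \<open>The majorant does not depend on \<sigma>, so it is integrable on the product
      because \<open>M\<close> is finite.\<close>
    have "(\<lambda>p. K' * (norm Q * (K * norm (f (snd p))))) \<in> borel_measurable (M \<Otimes>\<^sub>M M)" by measurable
    then show "integrable (M \<Otimes>\<^sub>M M) (\<lambda>p. K' * (norm Q * (K * norm (f (snd p)))))"
      using f_int by (intro MM.Fubini_integrable) auto
    show "(\<lambda>(\<sigma>, r). k \<sigma> r) \<in> borel_measurable (M \<Otimes>\<^sub>M M)"
    proof -
      have [measurable]: "fst \<in> borel_measurable (M \<Otimes>\<^sub>M M)" "snd \<in> borel_measurable (M \<Otimes>\<^sub>M M)"
        "(\<lambda>p. f (snd p)) \<in> borel_measurable (M \<Otimes>\<^sub>M M)"
        using measurable_compose[OF measurable_fst id_M] measurable_compose[OF measurable_snd id_M]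
          measurable_compose[OF measurable_snd f_M] by auto
      have [measurable]: "{p \<in> space (M \<Otimes>\<^sub>M M). snd p \<le> fst p} \<in> sets (M \<Otimes>\<^sub>M M)"
        by (rule borel_measurable_le) measurable
      have "(\<lambda>p. indicator {..fst p} (snd p) :: real) \<in> borel_measurable (M \<Otimes>\<^sub>M M)"
        by (rule borel_measurable_indicator') (simp add: pred_def)
      \<comment> \<open>Off the triangle \<open>\<sigma> - r\<close> is negative; as the extended
        semigroup is continuous at all times, the integrand is measurable on the whole
        product.\<close>
      then show ?thesis
        unfolding k_def split_beta'
        by (intro borel_measurable_scaleR R_meas blin_meas S_meas borel_measurable_diff) auto
    qed
    show "AE p in M \<Otimes>\<^sub>M M. norm (case p of (\<sigma>, r) \<Rightarrow> k \<sigma> r) \<le> norm (K' * (norm Q * (K * norm (f (snd p)))))"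
    proof (rule AE_I2)
      fix p assume "p \<in> space (M \<Otimes>\<^sub>M M)"
      then obtain \<sigma> r where p: "p = (\<sigma>, r)" "0 \<le> r" "\<sigma> \<le> t" "0 \<le> \<sigma>"
        by (auto simp: space_pair_measure space_M)
      have "norm (R (t - \<sigma>) (Q (S (\<sigma> - r) (f r)))) \<le> K' * (norm Q * (K * norm (f r)))"
        using p K(1) K'(1)
        by (intro order_trans[OF K'(2)] mult_left_mono order_trans[OF norm_blinfun]
            order_trans[OF K(2)]) auto
      then show "norm (case p of (\<sigma>, r) \<Rightarrow> k \<sigma> r) \<le> norm (K' * (norm Q * (K * norm (f (snd p)))))"
        using p K(1) K'(1) by (auto simp: k_def indicator_def abs_mult)
    qed
  qed
  have k_swap: "(LINT r|M. LINT \<sigma>|M. k \<sigma> r) = (LINT \<sigma>|M. LINT r|M. k \<sigma> r)"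
    by (rule MM.Fubini_integral[OF k_int])
  have k_fst: "integrable M (\<lambda>\<sigma>. LINT r|M. k \<sigma> r)" by (rule MM.integrable_fst[OF k_int])
  have k_snd: "integrable M (\<lambda>r. LINT \<sigma>|M. k \<sigma> r)" by (rule MM.integrable_snd[OF k_int])

  have RPf: "integrable M (\<lambda>r. R (t - r) (P (f r)))"
  proof (rule Bochner_Integration.integrable_bound)
    show "integrable M (\<lambda>r. K' * (norm P * norm (f r)))" using f_int by simp
    show "(\<lambda>r. R (t - r) (P (f r))) \<in> borel_measurable M"
      by (intro R_meas blin_meas) measurable
    show "AE r in M. norm (R (t - r) (P (f r))) \<le> norm (K' * (norm P * norm (f r)))"
      using K' by (intro AE_I2) (auto simp: space_M abs_mult
          intro!: order_trans[OF K'(2)] mult_left_mono norm_blinfun)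
  qed
  have RQS: "integrable M (\<lambda>\<sigma>. R (t - \<sigma>) (Q (S \<sigma> z0)))"
  proof (rule M.integrable_const_bound)
    show "AE r in M. norm (R (t - r) (Q (S r z0))) \<le> K' * (norm Q * (K * norm z0))"
    proof (rule AE_I2)
      fix r assume "r \<in> space M"
      then show "norm (R (t - r) (Q (S r z0))) \<le> K' * (norm Q * (K * norm z0))"
        using K(1) K'(1)
        by (intro order_trans[OF K'(2)] mult_left_mono order_trans[OF norm_blinfun] K(2)) (auto simp: space_M)
    qed
    show "(\<lambda>\<sigma>. R (t - \<sigma>) (Q (S \<sigma> z0))) \<in> borel_measurable M"
      by (intro R_meas blin_meas S_meas) measurable
  qed

  \<comment> \<open>Within \<open>{0..t}\<close> the condition
    \<open>r \<le> \<sigma> \<le> t\<close> reduces to the indicator in \<open>k\<close>, so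
    Duhamel's integral runs over all of \<open>M\<close>.\<close>
  have duh: "P (S (t - r) x) = R (t - r) (P x)
      + (LINT \<sigma>|M. indicator {..\<sigma>} r *\<^sub>R R (t - \<sigma>) (Q (S (\<sigma> - r) x)))" if "r \<in> {0..t}" for r x
  proof -
    have "P (S (t - r) x) - R (t - r) (P x) = (LINT \<sigma>:{r..t}|lebesgue. R (t - \<sigma>) (Q (S (\<sigma> - r) x)))"
      using that by (intro duhamel[OF S R _ _ dense, symmetric] PD comm) auto
    also have "\<dots> = (LINT \<sigma>|M. indicator {r..t} \<sigma> *\<^sub>R R (t - \<sigma>) (Q (S (\<sigma> - r) x)))"
      using that unfolding M_def by (intro set_integral_eq_lebesgue_on) auto
    also have "\<dots> = (LINT \<sigma>|M. indicator {..\<sigma>} r *\<^sub>R R (t - \<sigma>) (Q (S (\<sigma> - r) x)))"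
      by (intro Bochner_Integration.integral_cong) (auto simp: indicator_def space_M)
    finally show ?thesis by (simp add: algebra_simps)
  qed

  have "P (mild_solution S z0 f t)
      = P (S t z0) + (LINT r|M. P (indicator {..t} r *\<^sub>R S (t - r) (f r)))"
    using z[of t] t
    by (simp add: blinfun.add_right integral_bounded_linear[OF blinfun.bounded_linear_right Sf])
  also have "(LINT r|M. P (indicator {..t} r *\<^sub>R S (t - r) (f r)))
      = (LINT r|M. R (t - r) (P (f r)) + (LINT \<sigma>|M. k \<sigma> r))"
    by (intro Bochner_Integration.integral_cong) (auto simp: space_M duh k_def)
  also have "\<dots> = (LINT r|M. R (t - r) (P (f r))) + (LINT r|M. LINT \<sigma>|M. k \<sigma> r)"
    by (intro Bochner_Integration.integral_add RPf k_snd)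
  \<comment> \<open>The initial value is the case of starting time 0.\<close>
  also have "P (S t z0) = R t (P z0) + (LINT \<sigma>|M. R (t - \<sigma>) (Q (S \<sigma> z0)))"
  proof -
    have "(LINT \<sigma>|M. indicator {..\<sigma>} 0 *\<^sub>R R (t - \<sigma>) (Q (S (\<sigma> - 0) z0)))
        = (LINT \<sigma>|M. R (t - \<sigma>) (Q (S \<sigma> z0)))"
      by (intro Bochner_Integration.integral_cong) (auto simp: space_M)
    then show ?thesis using duh[of 0 z0] t by simp
  qed
  finally have Pz: "P (mild_solution S z0 f t) = R t (P z0) + (LINT \<sigma>|M. R (t - \<sigma>) (Q (S \<sigma> z0)))
      + ((LINT r|M. R (t - r) (P (f r))) + (LINT \<sigma>|M. LINT r|M. k \<sigma> r))"
    unfolding k_swap .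

  have w: "mild_solution R w0 (\<lambda>\<tau>. P (f \<tau>) + Q (mild_solution S z0 f \<tau>)) t = R t w0
      + (LINT \<sigma>|M. indicator {..t} \<sigma> *\<^sub>R R (t - \<sigma>) (P (f \<sigma>) + Q (mild_solution S z0 f \<sigma>)))"
    using t unfolding M_def by (intro mild_solution_eq_lebesgue_on) auto
  have "indicator {..t} \<sigma> *\<^sub>R R (t - \<sigma>) (P (f \<sigma>) + Q (mild_solution S z0 f \<sigma>))
      = R (t - \<sigma>) (P (f \<sigma>)) + (R (t - \<sigma>) (Q (S \<sigma> z0)) + (LINT r|M. k \<sigma> r))"
    if "\<sigma> \<in> space M" for \<sigma>
  proof -
    \<comment> \<open>The operator is bounded and linear, so it moves inside the inner integral,
      where it completes the kernel \<open>k\<close>.\<close>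
    have "R (t - \<sigma>) (Q (LINT r|M. indicator {..\<sigma>} r *\<^sub>R S (\<sigma> - r) (f r)))
        = (LINT r|M. (R (t - \<sigma>) o\<^sub>L Q) (indicator {..\<sigma>} r *\<^sub>R S (\<sigma> - r) (f r)))"
      using that
      by (subst integral_bounded_linear[OF blinfun.bounded_linear_right Sf]) (auto simp: space_M)
    also have "\<dots> = (LINT r|M. k \<sigma> r)"
      by (simp add: k_def blinfun.scaleR_right)
    finally show ?thesis using that z[of \<sigma>] by (simp add: space_M blinfun.add_right)
  qed
  then have "(LINT \<sigma>|M. indicator {..t} \<sigma> *\<^sub>R R (t - \<sigma>) (P (f \<sigma>) + Q (mild_solution S z0 f \<sigma>)))
      = (LINT \<sigma>|M. R (t - \<sigma>) (P (f \<sigma>)) + (R (t - \<sigma>) (Q (S \<sigma> z0)) + (LINT r|M. k \<sigma> r)))"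
    by (intro Bochner_Integration.integral_cong) auto
  also have "\<dots> = (LINT r|M. R (t - r) (P (f r)))
      + ((LINT \<sigma>|M. R (t - \<sigma>) (Q (S \<sigma> z0))) + (LINT \<sigma>|M. LINT r|M. k \<sigma> r))"
    using RPf RQS k_fst by simp
  finally show ?thesis unfolding w Pz by (simp add: blinfun.diff_right)
qed

lemma mild_solution_cong:
  assumes "0 \<le> t" "\<And>s. 0 \<le> s \<Longrightarrow> s \<le> t \<Longrightarrow> S s = S' s" "\<And>s. 0 \<le> s \<Longrightarrow> s \<le> t \<Longrightarrow> f s = f' s"
  shows "mild_solution S x f t = mild_solution S' x f' t"
proof -
  have "indicator {0..t} \<tau> *\<^sub>R S (t - \<tau>) (f \<tau>) = indicator {0..t} \<tau> *\<^sub>R S' (t - \<tau>) (f' \<tau>)" for \<tau>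
    using assms(2)[of "t - \<tau>"] assms(3)[of \<tau>] by (cases "\<tau> \<in> {0..t}") auto
  moreover have "S t = S' t" using assms(1,2) by simp
  ultimately show ?thesis
    by (simp only: mild_solution_def set_lebesgue_integral_def)
qed

text \<open>On a set of finite measure the bound
  \<open>norm (u x) \<le> 1 + (norm (u x))\<^sup>2\<close> gives integrability.\<close>

lemma square_integrable_imp_integrable_Icc:
  fixes u :: "real \<Rightarrow> 'b::euclidean_space"
  assumes "square_integrable {0<..} u"
  shows "integrable (lebesgue_on {0..t}) u"
proof -
  have "{0<..t} \<subseteq> {0<..}" by auto
  then have u: "square_integrable {0<..t} u"
    by (intro square_integrable_subset[OF assms]) auto
  note u_meas = u[unfolded square_integrable_def, THEN conjunct1]
    and u_sq = u[unfolded square_integrable_def, THEN conjunct2]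
  have "integrable (lebesgue_on {0<..t}) (\<lambda>x. 1 + (norm (u x))\<^sup>2)"
  proof -
    have "bounded {0<..t}"
      by (rule bounded_subset[OF bounded_closed_interval[of 0 t]]) auto
    then have "finite_measure (lebesgue_on {0<..t})"
      by (intro finite_measure_lebesgue_on bounded_set_imp_lmeasurable) auto
    then show ?thesis
      by (intro Bochner_Integration.integrable_add finite_measure.integrable_const u_sq)
  qed
  then have "integrable (lebesgue_on {0<..t}) u"
  proof (rule Bochner_Integration.integrable_bound[OF _ u_meas])
    have "norm (u x) \<le> 1 + (norm (u x))\<^sup>2" for x
    proof -
      have "2 * norm (u x) \<le> 1 + (norm (u x))\<^sup>2"
        using zero_le_power2[of "norm (u x) - 1"] by (simp add: power2_diff)
      then show ?thesis using norm_ge_zero[of "u x"] by linarith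
    qed
    then show "AE x in lebesgue_on {0<..t}. norm (u x) \<le> norm (1 + (norm (u x))\<^sup>2)"
      by (intro AE_I2) (simp add: abs_of_nonneg)
  qed
  then have int: "integrable lebesgue (\<lambda>x. indicator {0<..t} x *\<^sub>R u x)"
    by (simp add: integrable_restrict_space)
  \<comment> \<open>Square integrability is given on the open half-line, so \<open>u 0\<close> is
    arbitrary; the point 0 is added separately as a null set. Intersecting with
    \<open>{0..t}\<close> keeps the identity true for negative \<open>t\<close>.\<close>
  have "indicator {0..t} x *\<^sub>R u x
      = indicator {0<..t} x *\<^sub>R u x + indicator ({0} \<inter> {0..t}) x *\<^sub>R u 0" for x
    by (auto simp: indicator_def)
  moreover have "integrable lebesgue (\<lambda>x. indicator {0<..t} x *\<^sub>R u x + indicator ({0} \<inter> {0..t}) x *\<^sub>R u 0)"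
    by (intro Bochner_Integration.integrable_add int integrable_scaleR_left integrable_real_indicator)
      (auto simp: Int_insert_left)
  ultimately have "integrable lebesgue (\<lambda>x. indicator {0..t} x *\<^sub>R u x)" by presburger
  then show ?thesis by (simp add: integrable_restrict_space)
qed

theorem theorem3p8:
  fixes \<Omega> \<omega> :: "(real^'n) set"
    and valZ :: "'z::{real_inner,banach,second_countable_topology} \<Rightarrow> real^'n \<Rightarrow> real"
    and valW :: "'w::{real_inner,banach,second_countable_topology} \<Rightarrow> real^'n \<Rightarrow> real"
    and S :: "real \<Rightarrow> 'z \<Rightarrow>\<^sub>L 'z"
    and B :: "(real^'p) \<Rightarrow>\<^sub>L 'z" and C :: "'z \<Rightarrow>\<^sub>L (real^'q)"
    and T :: "'z \<Rightarrow>\<^sub>L 'z" and \<chi>\<omega> T\<omega> :: "'z \<Rightarrow> 'w"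
    and DL :: "'w set" and L :: "'w \<Rightarrow> 'w" and SL :: "real \<Rightarrow> 'w \<Rightarrow>\<^sub>L 'w"
    and G :: "(real^'p) \<Rightarrow>\<^sub>L 'w" and H :: "(real^'q) \<Rightarrow>\<^sub>L 'w"
  assumes \<chi>\<omega>_def: "\<chi>\<omega> = restriction \<omega> valZ valW" and T\<omega>_def: "T\<omega> = (\<lambda>z. \<chi>\<omega> (T z))"
    and "open \<Omega>" and "bounded \<Omega>" and "smooth_boundary \<Omega>"
    and "open \<omega>" and "\<omega> \<noteq> {}" and "\<omega> \<subseteq> \<Omega>"
    and Z: "is_H1 \<Omega> valZ" and W: "is_H1 \<omega> valW"
    and laplacian_generates: "generates (laplacian_dom \<Omega> valZ) (laplacian \<Omega> valZ) S"
    and "self_adjoint (laplacian_dom \<Omega> valZ) (laplacian \<Omega> valZ)"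
    and "compact_resolvent (laplacian_dom \<Omega> valZ) (laplacian \<Omega> valZ)"
    and L: "estimator_operator \<omega> valW DL L SL"
    and cond1: "\<exists>(M :: (real^'q) \<Rightarrow>\<^sub>L 'w) (N :: 'w \<Rightarrow>\<^sub>L 'w). \<forall>z. M (C z) + N (T\<omega> z) = \<chi>\<omega> z"
    and cond2: "\<forall>z\<in>laplacian_dom \<Omega> valZ. T\<omega> z \<in> DL \<and>
        T\<omega> (laplacian \<Omega> valZ z) - L (T\<omega> z) = H (C z)"
    and cond2': "\<forall>v. G v = T\<omega> (B v)"
  shows "\<omega>EG_estimator S (laplacian_dom \<Omega> valZ) B C T\<omega> SL DL G H \<and>
    \<omega>EG_observable \<omega> valW S (laplacian_dom \<Omega> valZ) B C T\<omega>"
proof -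
  have dense: "closure (laplacian_dom \<Omega> valZ) = UNIV"
    using \<open>self_adjoint _ _\<close> by (simp add: self_adjoint_def)
  have genL: "generates DL L SL" and stab: "exponentially_stable SL"
    using L by (auto simp: estimator_operator_def)
  have C0: "C0_semigroup S" "C0_semigroup SL"
    using laplacian_generates genL unfolding generates_def by blast+
  \<comment> \<open>\<open>T\<omega>\<close> enters as a plain function; boundedness of the
    restriction makes it a bounded operator \<open>P\<close>, as the variation of constants
    requires.\<close>
  have "bounded_linear \<chi>\<omega>"
    unfolding \<chi>\<omega>_def using bounded_linear_restriction W Z \<open>open \<Omega>\<close> \<open>open \<omega>\<close> \<open>\<omega> \<subseteq> \<Omega>\<close> .
  then have "bounded_linear T\<omega>"
    unfolding T\<omega>_def by (rule bounded_linear_compose) (rule blinfun.bounded_linear_right)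
  then obtain P where P: "T\<omega> = blinfun_apply P"
    by (metis bounded_linear_Blinfun_apply)
  \<comment> \<open>Mild solutions at nonnegative times involve the semigroups at nonnegative times
    only, so clamping does not change them.\<close>
  define S' where "S' = (\<lambda>s. S (max 0 s))"
  define SL' where "SL' = (\<lambda>s. SL (max 0 s))"
  obtain F \<sigma> where F: "\<sigma> > 0" "\<And>t. t \<ge> 0 \<Longrightarrow> norm (SL t) \<le> F * exp (- \<sigma> * t)"
    using stab unfolding exponentially_stable_def by blast
  have "((\<lambda>t. norm (T\<omega> (mild_solution S z0 (\<lambda>\<tau>. B (u \<tau>)) t) -
      mild_solution SL w0 (\<lambda>\<tau>. G (u \<tau>) + H (C (mild_solution S z0 (\<lambda>\<tau>. B (u \<tau>)) \<tau>))) t)) \<longlongrightarrow> 0) at_top"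
    (is "((\<lambda>t. norm (?e t)) \<longlongrightarrow> 0) at_top")
    if u: "square_integrable {0<..} u" for z0 w0 u
  proof -
    have e: "?e t = SL t (P z0 - w0)" if t: "0 \<le> t" for t
    proof -
      have z: "mild_solution S z0 (\<lambda>\<tau>. B (u \<tau>)) s = mild_solution S' z0 (\<lambda>\<tau>. B (u \<tau>)) s" if "0 \<le> s" for s
        using that by (intro mild_solution_cong) (auto simp: S'_def)
      \<comment> \<open>The condition on \<open>G\<close> turns the control term into
        \<open>P\<close> applied to the input of the diffusion system, the form required by
        \<open>mild_solution_error\<close>.\<close>
      have w: "mild_solution SL w0 (\<lambda>\<tau>. G (u \<tau>) + H (C (mild_solution S z0 (\<lambda>\<tau>. B (u \<tau>)) \<tau>))) t
          = mild_solution SL' w0 (\<lambda>\<tau>. P (B (u \<tau>)) + (H o\<^sub>L C) (mild_solution S' z0 (\<lambda>\<tau>. B (u \<tau>)) \<tau>)) t"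
        using t by (intro mild_solution_cong) (auto simp: SL'_def z cond2' P)
      have "?e t = SL' t (P z0 - w0)"
        unfolding w z[OF t] P
      proof (rule mild_solution_error)
        show "generates (laplacian_dom \<Omega> valZ) (laplacian \<Omega> valZ) S'" "extended_semigroup S'"
          "generates DL L SL'" "extended_semigroup SL'"
          unfolding S'_def SL'_def
          by (intro generates_max extended_semigroup_max laplacian_generates genL C0)+
        show "integrable (lebesgue_on {0..t}) (\<lambda>\<tau>. B (u \<tau>))"
          by (intro integrable_bounded_linear[OF blinfun.bounded_linear_right]
              square_integrable_imp_integrable_Icc u)
      qed (use dense cond2 t in \<open>auto simp: P\<close>)
      then show ?thesis using t by (simp add: SL'_def max_absorb2)
    qed
    show ?thesis
    \<comment> \<open>For nonnegative times the error is \<open>SL t\<close> applied to the initial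
      error, and exponential stability supplies the upper bound of the sandwich.\<close>
    proof (rule tendsto_sandwich[OF _ _ tendsto_const])
      have "((\<lambda>t. exp (- \<sigma> * t)) \<longlongrightarrow> 0) at_top"
        using F(1)
        by (intro filterlim_compose[OF exp_at_bot] filterlim_tendsto_neg_mult_at_bot[OF tendsto_const]
            filterlim_ident) simp
      then show "((\<lambda>t. F * exp (- \<sigma> * t) * norm (P z0 - w0)) \<longlongrightarrow> 0) at_top"
        by (intro tendsto_mult_left_zero tendsto_mult_right_zero)
      show "\<forall>\<^sub>F t in at_top. norm (?e t) \<le> F * exp (- \<sigma> * t) * norm (P z0 - w0)"
        using eventually_ge_at_top[of 0]
      proof eventually_elim
        case (elim t)
        have "norm (SL t (P z0 - w0)) \<le> norm (SL t) * norm (P z0 - w0)" by (rule norm_blinfun)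
        also have "\<dots> \<le> F * exp (- \<sigma> * t) * norm (P z0 - w0)"
          by (intro mult_right_mono F elim norm_ge_zero)
        finally show ?case unfolding e[OF elim] .
      qed
    qed simp
  qed
  then have est: "\<omega>EG_estimator S (laplacian_dom \<Omega> valZ) B C T\<omega> SL DL G H"
    using cond2 by (auto simp: \<omega>EG_estimator_def Let_def)
  then show ?thesis using L unfolding \<omega>EG_observable_def by blast
qed

end
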